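(* Let $A\subseteq B$ be an extension of rings and let $b\in B$ be transcendental over $A$. Let $R$ be an $A$-algebra, let $D:R\to R\otimes_A B$ be a derivation, and let $E:R\otimes_A A[b]\to R\otimes_A B$ be a derivation. Then every $(R\otimes_A B)$-valued biderivation on $R$ extends uniquely to an $(R\otimes_A B)$-valued biderivation on $R\otimes_A A[b]$ satisfying (i) $\{r\otimes 1,1\otimes b\}=D(r)$ for all $r\in R$, and (ii) $\{1\otimes b,x\}=E(x)$ for all $x\in R\otimes_A A[b]$.
   Context: All rings are commutative and unital. The element $b$ is transcendental over $A$ means that $A[b]$ is a polynomial ring in $b$ over $A$. The modules are the natural ones: $R\otimes_A B$ is a module over $R$ and over $R\otimes_A A[b]$ in the natural way. Derivations and biderivations are not assumed to be $A$-linear. For a ring $R$ and an $R$-module $M$, an $M$-valued derivation on $R$ is an additive map $d:R\to M$ with $d(xy)=x\,d(y)+y\,d(x)$. An $M$-valued biderivation on $R$ is a function $\{\cdot,\cdot\}:R\times R\to M$ such that for each $r\in R$ both $\{r,\cdot\}$ and $\{\cdot,r\}$ are $M$-valued derivations on $R$. An $M$-valued biderivation on an $R$-algebra $R'$ (with $M$ an $R'$-module) extends an $M$-valued biderivation on $R$ if its value at the images of $r,s\in R$ in $R'$ equals $\{r,s\}$, for all $r,s\in R$. *)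

theory Defs
  imports "HOL-Algebra.Algebra"
begin

section \<open>Rings as modules along a homomorphism\<close>

text \<open>
  The ring \<open>T\<close>, with \<open>s\<close> acting as multiplication by \<open>f s\<close>. For \<open>f\<close> a homomorphism
  from \<open>S\<close> to \<open>T\<close> this is \<open>T\<close> as an \<open>S\<close>-algebra, and in particular as an \<open>S\<close>-module.
\<close>

definition scalars_along :: "('s \<Rightarrow> 't) \<Rightarrow> ('t, 'm) ring_scheme \<Rightarrow> ('s, 't) module"
  where "scalars_along f T =
    \<lparr>carrier = carrier T, monoid.mult = monoid.mult T, one = one T,
     ring.zero = ring.zero T, ring.add = ring.add T, smult = (\<lambda>s t. f s \<otimes>\<^bsub>T\<^esub> t)\<rparr>"

lemma scalars_along_simps [simp]:
  "carrier (scalars_along f T) = carrier T"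
  "monoid.mult (scalars_along f T) = monoid.mult T"
  "one (scalars_along f T) = one T"
  "ring.zero (scalars_along f T) = ring.zero T"
  "ring.add (scalars_along f T) = ring.add T"
  "s \<odot>\<^bsub>scalars_along f T\<^esub> t = f s \<otimes>\<^bsub>T\<^esub> t"
  by (simp_all add: scalars_along_def)

lemma scalars_along_algebra:
  assumes "cring S" "cring T" "f \<in> ring_hom S T"
  shows "algebra S (scalars_along f T)"
proof -
  interpret S: cring S by fact
  interpret T: cring T by fact
  have f: "f x \<in> carrier T" if "x \<in> carrier S" for x
    using assms(3) that by (rule ring_hom_closed)
  have c: "cring (scalars_along f T)"
  proof (rule cringI)
    show "abelian_group (scalars_along f T)"
      by (rule abelian_groupI) (simp_all add: T.a_ac T.add.l_inv_ex)
    show "Group.comm_monoid (scalars_along f T)"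
      by (rule comm_monoidI) (simp_all add: T.m_ac)
  qed (simp add: T.l_distr)
  show ?thesis
    by (rule algebraI[OF \<open>cring S\<close> c])
      (auto simp: f ring_hom_add[OF assms(3)] ring_hom_mult[OF assms(3)] ring_hom_one[OF assms(3)]
        T.l_distr T.r_distr T.m_assoc)
qed


section \<open>Tensor products of algebras\<close>

text \<open>
  The free abelian group on \<open>carrier M \<times> carrier N\<close>, made into a ring by extending
  \<open>(x, y) (x', y') = (x x', y y')\<close> biadditively.
\<close>

definition frag_mult ::
    "('m, 'p) ring_scheme \<Rightarrow> ('n, 'q) ring_scheme \<Rightarrow>
      ('m \<times> 'n \<Rightarrow>\<^sub>0 int) \<Rightarrow> ('m \<times> 'n \<Rightarrow>\<^sub>0 int) \<Rightarrow> ('m \<times> 'n \<Rightarrow>\<^sub>0 int)"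
  where "frag_mult M N u v =
    frag_extend (\<lambda>(x, y). frag_extend (\<lambda>(x', y'). frag_of (x \<otimes>\<^bsub>M\<^esub> x', y \<otimes>\<^bsub>N\<^esub> y')) v) u"

definition pair_ring ::
    "('m, 'p) ring_scheme \<Rightarrow> ('n, 'q) ring_scheme \<Rightarrow> ('m \<times> 'n \<Rightarrow>\<^sub>0 int) ring"
  where "pair_ring M N =
    \<lparr>carrier = carrier (free_Abelian_group (carrier M \<times> carrier N)),
     monoid.mult = frag_mult M N, one = frag_of (\<one>\<^bsub>M\<^esub>, \<one>\<^bsub>N\<^esub>), ring.zero = 0, ring.add = (+)\<rparr>"

lemma frag_mult_of [simp]:
  "frag_mult M N (frag_of (x, y)) (frag_of (x', y')) = frag_of (x \<otimes>\<^bsub>M\<^esub> x', y \<otimes>\<^bsub>N\<^esub> y')"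
  by (simp add: frag_mult_def)

lemma frag_mult_0_left [simp]: "frag_mult M N 0 v = 0"
  by (simp add: frag_mult_def)

lemma frag_mult_diff_left: "frag_mult M N (u - u') v = frag_mult M N u v - frag_mult M N u' v"
  by (simp add: frag_mult_def frag_extend_diff)

lemma frag_mult_diff_right: "frag_mult M N u (v - v') = frag_mult M N u v - frag_mult M N u v'"
  using subset_UNIV
proof (induction u rule: frag_induction)
  case (one a)
  show ?case by (cases a) (simp add: frag_mult_def frag_extend_diff)
qed (simp_all add: frag_mult_diff_left)

lemma frag_mult_0_right [simp]: "frag_mult M N u 0 = 0"
  using frag_mult_diff_right[of M N u 0 0] by simp

lemma frag_mult_add_left: "frag_mult M N (u + u') v = frag_mult M N u v + frag_mult M N u' v"
  by (simp add: frag_mult_def frag_extend_add)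

lemma frag_mult_add_right: "frag_mult M N u (v + v') = frag_mult M N u v + frag_mult M N u v'"
proof -
  have "frag_mult M N u (v - (0 - v')) = frag_mult M N u v - (frag_mult M N u 0 - frag_mult M N u v')"
    by (simp only: frag_mult_diff_right)
  then show ?thesis by simp
qed

lemma pair_ring_simps:
  "carrier (pair_ring M N) = {c. Poly_Mapping.keys c \<subseteq> carrier M \<times> carrier N}"
  "monoid.mult (pair_ring M N) = frag_mult M N"
  "one (pair_ring M N) = frag_of (\<one>\<^bsub>M\<^esub>, \<one>\<^bsub>N\<^esub>)"
  "ring.zero (pair_ring M N) = 0"
  "ring.add (pair_ring M N) = (+)"
  by (simp_all add: pair_ring_def free_Abelian_group_def)

lemma keys_diff_subset:
  fixes u v :: "'a \<Rightarrow>\<^sub>0 int"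
  assumes "Poly_Mapping.keys u \<subseteq> S" "Poly_Mapping.keys v \<subseteq> S"
  shows "Poly_Mapping.keys (u - v) \<subseteq> S"
  using order_trans[OF keys_diff Un_least[OF assms]] .

lemma pair_ring_cring:
  fixes M :: "('m, 'p) ring_scheme" and N :: "('n, 'q) ring_scheme"
  assumes "cring M" "cring N"
  shows "cring (pair_ring M N)"
proof -
  interpret M: cring M by fact
  interpret N: cring N by fact
  let ?S = "carrier M \<times> carrier N"
  have closed: "Poly_Mapping.keys (frag_mult M N u v) \<subseteq> ?S"
    if u: "Poly_Mapping.keys u \<subseteq> ?S" and v: "Poly_Mapping.keys v \<subseteq> ?S" for u v
    using u
  proof (induction u rule: frag_induction)
    case (one a)
    show ?case
      using v
    proof (induction v rule: frag_induction)
      case (one c)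
      then show ?case using \<open>a \<in> ?S\<close> by (cases a; cases c) simp
    qed (simp_all add: frag_mult_diff_right keys_diff_subset)
  qed (simp_all add: frag_mult_diff_left keys_diff_subset)
  have comm: "frag_mult M N u v = frag_mult M N v u"
    if u: "Poly_Mapping.keys u \<subseteq> ?S" and v: "Poly_Mapping.keys v \<subseteq> ?S" for u v
    using u
  proof (induction u rule: frag_induction)
    case (one a)
    show ?case
      using v
    proof (induction v rule: frag_induction)
      case (one c)
      then show ?case using \<open>a \<in> ?S\<close> by (cases a; cases c) (auto simp: M.m_comm N.m_comm)
    qed (simp_all add: frag_mult_diff_right frag_mult_diff_left)
  qed (simp_all add: frag_mult_diff_right frag_mult_diff_left)
  have assoc: "frag_mult M N (frag_mult M N u v) w = frag_mult M N u (frag_mult M N v w)"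
    if u: "Poly_Mapping.keys u \<subseteq> ?S" and v: "Poly_Mapping.keys v \<subseteq> ?S"
      and w: "Poly_Mapping.keys w \<subseteq> ?S" for u v w
    using u
  proof (induction u rule: frag_induction)
    case (one a)
    show ?case
      using v
    proof (induction v rule: frag_induction)
      case (one c)
      show ?case
        using w
      proof (induction w rule: frag_induction)
        case (one e)
        then show ?case using \<open>a \<in> ?S\<close> \<open>c \<in> ?S\<close>
          by (cases a; cases c; cases e) (auto simp: M.m_assoc N.m_assoc)
      qed (simp_all add: frag_mult_diff_right frag_mult_diff_left)
    qed (simp_all add: frag_mult_diff_right frag_mult_diff_left)
  qed (simp_all add: frag_mult_diff_right frag_mult_diff_left)
  have unit: "frag_mult M N (frag_of (\<one>\<^bsub>M\<^esub>, \<one>\<^bsub>N\<^esub>)) u = u"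
    if "Poly_Mapping.keys u \<subseteq> ?S" for u
    using that
    by (induction u rule: frag_induction) (auto simp: frag_mult_diff_right)
  show ?thesis
  proof (rule cringI)
    show "abelian_group (pair_ring M N)"
    proof (rule abelian_groupI; unfold pair_ring_simps)
      fix u :: "'m \<times> 'n \<Rightarrow>\<^sub>0 int"
      assume u: "u \<in> {c. Poly_Mapping.keys c \<subseteq> ?S}"
      then show "\<exists>v\<in>{c. Poly_Mapping.keys c \<subseteq> ?S}. v + u = 0"
        by (intro bexI[of _ "- u"]) auto
    next
      fix u v :: "'m \<times> 'n \<Rightarrow>\<^sub>0 int"
      assume "u \<in> {c. Poly_Mapping.keys c \<subseteq> ?S}" "v \<in> {c. Poly_Mapping.keys c \<subseteq> ?S}"
      then show "u + v \<in> {c. Poly_Mapping.keys c \<subseteq> ?S}"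
        using Poly_Mapping.keys_add[of u v] by blast
    qed (auto simp: add.assoc add.commute)
    show "Group.comm_monoid (pair_ring M N)"
    proof (rule comm_monoidI; unfold pair_ring_simps mem_Collect_eq)
      show "Poly_Mapping.keys (frag_of (\<one>\<^bsub>M\<^esub>, \<one>\<^bsub>N\<^esub>)) \<subseteq> ?S" by simp
    qed (fact closed assoc unit comm)+
  qed (simp add: pair_ring_simps(2,5) frag_mult_add_left)
qed

definition tensor_gens ::
    "('a, 'k) ring_scheme \<Rightarrow> ('a, 'm, 'p) module_scheme \<Rightarrow> ('a, 'n, 'q) module_scheme \<Rightarrow>
      ('m \<times> 'n \<Rightarrow>\<^sub>0 int) set"
  where "tensor_gens K M N =
    {frag_of (x \<oplus>\<^bsub>M\<^esub> x', y) - frag_of (x, y) - frag_of (x', y) | x x' y.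
       x \<in> carrier M \<and> x' \<in> carrier M \<and> y \<in> carrier N} \<union>
    {frag_of (x, y \<oplus>\<^bsub>N\<^esub> y') - frag_of (x, y) - frag_of (x, y') | x y y'.
       x \<in> carrier M \<and> y \<in> carrier N \<and> y' \<in> carrier N} \<union>
    {frag_of (a \<odot>\<^bsub>M\<^esub> x, y) - frag_of (x, a \<odot>\<^bsub>N\<^esub> y) | a x y.
       a \<in> carrier K \<and> x \<in> carrier M \<and> y \<in> carrier N}"

text \<open>The additive subgroup generated by the relations; it is an ideal of \<^term>\<open>pair_ring M N\<close>.\<close>

definition tensor_rels ::
    "('a, 'k) ring_scheme \<Rightarrow> ('a, 'm, 'p) module_scheme \<Rightarrow> ('a, 'n, 'q) module_scheme \<Rightarrow>
      ('m \<times> 'n \<Rightarrow>\<^sub>0 int) set"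
  where "tensor_rels K M N =
    generate (free_Abelian_group (carrier M \<times> carrier N)) (tensor_gens K M N)"

lemma tensor_gensI:
  "x \<in> carrier M \<Longrightarrow> x' \<in> carrier M \<Longrightarrow> y \<in> carrier N \<Longrightarrow>
    frag_of (x \<oplus>\<^bsub>M\<^esub> x', y) - frag_of (x, y) - frag_of (x', y) \<in> tensor_gens K M N"
  "x \<in> carrier M \<Longrightarrow> y \<in> carrier N \<Longrightarrow> y' \<in> carrier N \<Longrightarrow>
    frag_of (x, y \<oplus>\<^bsub>N\<^esub> y') - frag_of (x, y) - frag_of (x, y') \<in> tensor_gens K M N"
  "a \<in> carrier K \<Longrightarrow> x \<in> carrier M \<Longrightarrow> y \<in> carrier N \<Longrightarrow>
    frag_of (a \<odot>\<^bsub>M\<^esub> x, y) - frag_of (x, a \<odot>\<^bsub>N\<^esub> y) \<in> tensor_gens K M N"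
  unfolding tensor_gens_def by blast+

lemma tensor_gensE:
  assumes "u \<in> tensor_gens K M N"
  obtains
    (add_left) x x' y where "x \<in> carrier M" "x' \<in> carrier M" "y \<in> carrier N"
      "u = frag_of (x \<oplus>\<^bsub>M\<^esub> x', y) - frag_of (x, y) - frag_of (x', y)"
  | (add_right) x y y' where "x \<in> carrier M" "y \<in> carrier N" "y' \<in> carrier N"
      "u = frag_of (x, y \<oplus>\<^bsub>N\<^esub> y') - frag_of (x, y) - frag_of (x, y')"
  | (balance) a x y where "a \<in> carrier K" "x \<in> carrier M" "y \<in> carrier N"
      "u = frag_of (a \<odot>\<^bsub>M\<^esub> x, y) - frag_of (x, a \<odot>\<^bsub>N\<^esub> y)"
  using assms unfolding tensor_gens_def by blast

lemma tensor_gens_carrier: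
  assumes "algebra K M" "algebra K N"
  shows "tensor_gens K M N \<subseteq> carrier (free_Abelian_group (carrier M \<times> carrier N))"
proof
  interpret M: algebra K M by fact
  interpret N: algebra K N by fact
  fix u assume "u \<in> tensor_gens K M N"
  then show "u \<in> carrier (free_Abelian_group (carrier M \<times> carrier N))"
    by (cases rule: tensor_gensE; simp only: carrier_free_Abelian_group_iff; intro keys_diff_subset; simp)
qed

lemma tensor_rels_subgroup:
  assumes "algebra K M" "algebra K N"
  shows "subgroup (tensor_rels K M N) (free_Abelian_group (carrier M \<times> carrier N))"
  unfolding tensor_rels_def
  by (rule group.generate_is_subgroup[OF group_free_Abelian_group tensor_gens_carrier[OF assms]])

lemma tensor_rels_diff:
  assumes "algebra K M" "algebra K N" "u \<in> tensor_rels K M N" "v \<in> tensor_rels K M N"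
  shows "u - v \<in> tensor_rels K M N"
proof -
  note sub = tensor_rels_subgroup[OF assms(1,2)]
  have "Poly_Mapping.keys v \<subseteq> carrier M \<times> carrier N"
    using subsetD[OF subgroup.subset[OF sub] assms(4)] by simp
  then show ?thesis
    using subgroup.m_closed[OF sub assms(3) subgroup.m_inv_closed[OF sub assms(4)]] by simp
qed

lemma tensor_rels_zero: "0 \<in> tensor_rels K M N"
  unfolding tensor_rels_def
  using generate.one[of "free_Abelian_group (carrier M \<times> carrier N)"] by simp

lemma tensor_rels_induct [consumes 3, case_names zero gen diff]:
  assumes "algebra K M" "algebra K N" "u \<in> tensor_rels K M N"
    and "Q 0" "\<And>u. u \<in> tensor_gens K M N \<Longrightarrow> Q u" "\<And>u v. Q u \<Longrightarrow> Q v \<Longrightarrow> Q (u - v)"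
  shows "Q u"
  using assms(3) unfolding tensor_rels_def
proof (induction rule: generate.induct)
  case (inv h)
  then have "Poly_Mapping.keys h \<subseteq> carrier M \<times> carrier N"
    using subsetD[OF tensor_gens_carrier[OF assms(1,2)] inv] by simp
  then show ?case using assms(6)[OF assms(4) assms(5)[OF inv]] by simp
next
  case (eng u v)
  then show ?case using assms(6)[OF eng(3) assms(6)[OF assms(4) eng(4)]] by simp
qed (use assms(4,5) in simp_all)

lemma tensor_rels_ideal:
  assumes "algebra K M" "algebra K N"
  shows "ideal (tensor_rels K M N) (pair_ring M N)"
proof -
  interpret MR: cring M by (rule algebra.axioms(2)[OF assms(1)])
  interpret NR: cring N by (rule algebra.axioms(2)[OF assms(2)])
  interpret M: algebra K M by fact
  interpret N: algebra K N by fact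
  interpret Q: cring "pair_ring M N"
    by (intro pair_ring_cring algebra.axioms(2)[OF assms(1)] algebra.axioms(2)[OF assms(2)])
  let ?S = "carrier M \<times> carrier N"
  have F: "add_monoid (pair_ring M N) = free_Abelian_group ?S"
    by (simp add: pair_ring_def free_Abelian_group_def)
  note diff = tensor_rels_diff[OF assms]
  have gen: "frag_mult M N v u \<in> tensor_rels K M N"
    if u: "u \<in> tensor_gens K M N" and v: "Poly_Mapping.keys v \<subseteq> ?S" for u v
    using v
  proof (induction v rule: frag_induction)
    case (one c)
    then obtain s t where c: "c = (s, t)" "s \<in> carrier M" "t \<in> carrier N" by auto
    have "frag_mult M N (frag_of c) u \<in> tensor_gens K M N"
      using u
    proof (cases rule: tensor_gensE)
      case (add_left x x' y)
      then show ?thesis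
        using c tensor_gensI(1)[of "s \<otimes>\<^bsub>M\<^esub> x" M "s \<otimes>\<^bsub>M\<^esub> x'" "t \<otimes>\<^bsub>N\<^esub> y" N K]
        by (simp add: frag_mult_diff_right MR.r_distr)
    next
      case (add_right x y y')
      then show ?thesis
        using c tensor_gensI(2)[of "s \<otimes>\<^bsub>M\<^esub> x" M "t \<otimes>\<^bsub>N\<^esub> y" N "t \<otimes>\<^bsub>N\<^esub> y'" K]
        by (simp add: frag_mult_diff_right NR.r_distr)
    next
      case (balance a x y)
      have "s \<otimes>\<^bsub>M\<^esub> (a \<odot>\<^bsub>M\<^esub> x) = a \<odot>\<^bsub>M\<^esub> (s \<otimes>\<^bsub>M\<^esub> x)"
        using balance c M.smult_assoc2[of a x s] by (simp add: MR.m_comm)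
      moreover have "t \<otimes>\<^bsub>N\<^esub> (a \<odot>\<^bsub>N\<^esub> y) = a \<odot>\<^bsub>N\<^esub> (t \<otimes>\<^bsub>N\<^esub> y)"
        using balance c N.smult_assoc2[of a y t] by (simp add: NR.m_comm)
      ultimately show ?thesis
        using c balance tensor_gensI(3)[of a K "s \<otimes>\<^bsub>M\<^esub> x" M "t \<otimes>\<^bsub>N\<^esub> y" N]
        by (simp add: frag_mult_diff_right)
    qed
    then show ?case unfolding tensor_rels_def by (rule generate.incl)
  qed (simp_all add: tensor_rels_zero frag_mult_diff_left diff)
  have l_closed: "frag_mult M N v u \<in> tensor_rels K M N"
    if u: "u \<in> tensor_rels K M N" and v: "Poly_Mapping.keys v \<subseteq> ?S" for u v
    using assms u
    by (induction u rule: tensor_rels_induct)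
      (simp_all add: tensor_rels_zero frag_mult_diff_right diff gen v)
  show ?thesis
  proof (rule idealI)
    show "ring (pair_ring M N)" by (rule Q.ring_axioms)
    show sub: "subgroup (tensor_rels K M N) (add_monoid (pair_ring M N))"
      unfolding F by (rule tensor_rels_subgroup[OF assms])
    fix u v assume u: "u \<in> tensor_rels K M N" and v: "v \<in> carrier (pair_ring M N)"
    show "v \<otimes>\<^bsub>pair_ring M N\<^esub> u \<in> tensor_rels K M N"
      using l_closed[OF u] v by (simp add: pair_ring_simps)
    moreover have "u \<in> carrier (pair_ring M N)"
      using subgroup.subset[OF sub] u by auto
    ultimately show "u \<otimes>\<^bsub>pair_ring M N\<^esub> v \<in> tensor_rels K M N"
      using v Q.m_comm by simp
  qed
qed

definition tensor ::
    "('a, 'k) ring_scheme \<Rightarrow> ('a, 'm, 'p) module_scheme \<Rightarrow> ('a, 'n, 'q) module_scheme \<Rightarrow>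
      ('m \<times> 'n \<Rightarrow>\<^sub>0 int) set ring"
  where "tensor K M N = pair_ring M N Quot tensor_rels K M N"

lemma tensor_cring:
  assumes "algebra K M" "algebra K N"
  shows "cring (tensor K M N)"
proof -
  interpret M: algebra K M by fact
  interpret N: algebra K N by fact
  interpret Q: cring "pair_ring M N"
    by (intro pair_ring_cring algebra.axioms(2)[OF assms(1)] algebra.axioms(2)[OF assms(2)])
  show ?thesis
    unfolding tensor_def
    by (rule ideal.quotient_is_cring[OF tensor_rels_ideal[OF assms] Q.cring_axioms])
qed

definition pure_tensor ::
    "('a, 'k) ring_scheme \<Rightarrow> ('a, 'm, 'p) module_scheme \<Rightarrow> ('a, 'n, 'q) module_scheme \<Rightarrow>
      'm \<Rightarrow> 'n \<Rightarrow> ('m \<times> 'n \<Rightarrow>\<^sub>0 int) set"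
  where "pure_tensor K M N x y = tensor_rels K M N +>\<^bsub>pair_ring M N\<^esub> frag_of (x, y)"

lemma tensor_proj_eqI:
  assumes "algebra K M" "algebra K N" "u - v \<in> tensor_rels K M N"
    "u \<in> carrier (pair_ring M N)" "v \<in> carrier (pair_ring M N)"
  shows "tensor_rels K M N +>\<^bsub>pair_ring M N\<^esub> u = tensor_rels K M N +>\<^bsub>pair_ring M N\<^esub> v"
proof -
  interpret I: ideal "tensor_rels K M N" "pair_ring M N"
    by (rule tensor_rels_ideal[OF assms(1,2)])
  have "u = (u - v) \<oplus>\<^bsub>pair_ring M N\<^esub> v"
    by (simp add: pair_ring_simps)
  then have "u \<in> tensor_rels K M N +>\<^bsub>pair_ring M N\<^esub> v"
    using assms(3) by (auto simp: a_r_coset_def')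
  then show ?thesis
    using I.a_repr_independence'[OF _ assms(5)] by simp
qed

lemma pure_tensor_add_left:
  assumes "algebra K M" "algebra K N" "x \<in> carrier M" "x' \<in> carrier M" "y \<in> carrier N"
  shows "pure_tensor K M N (x \<oplus>\<^bsub>M\<^esub> x') y =
    pure_tensor K M N x y \<oplus>\<^bsub>tensor K M N\<^esub> pure_tensor K M N x' y"
proof -
  interpret M: algebra K M by fact
  interpret I: ideal "tensor_rels K M N" "pair_ring M N"
    by (rule tensor_rels_ideal[OF assms(1,2)])
  have c: "frag_of (x, y) \<in> carrier (pair_ring M N)" "frag_of (x', y) \<in> carrier (pair_ring M N)"
    "frag_of (x \<oplus>\<^bsub>M\<^esub> x', y) \<in> carrier (pair_ring M N)"
    using assms by (auto simp: pair_ring_simps)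
  have "pure_tensor K M N (x \<oplus>\<^bsub>M\<^esub> x') y =
      tensor_rels K M N +>\<^bsub>pair_ring M N\<^esub> (frag_of (x, y) \<oplus>\<^bsub>pair_ring M N\<^esub> frag_of (x', y))"
    unfolding pure_tensor_def
  proof (rule tensor_proj_eqI[OF assms(1,2) _ c(3) I.add.m_closed[OF c(1,2)]])
    have "frag_of (x \<oplus>\<^bsub>M\<^esub> x', y) - (frag_of (x, y) \<oplus>\<^bsub>pair_ring M N\<^esub> frag_of (x', y)) \<in> tensor_gens K M N"
      using tensor_gensI(1)[OF assms(3-5)] by (simp add: pair_ring_simps diff_diff_eq)
    then show "frag_of (x \<oplus>\<^bsub>M\<^esub> x', y) - (frag_of (x, y) \<oplus>\<^bsub>pair_ring M N\<^esub> frag_of (x', y)) \<in> tensor_rels K M N"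
      unfolding tensor_rels_def by (rule generate.incl)
  qed
  also have "\<dots> = pure_tensor K M N x y \<oplus>\<^bsub>tensor K M N\<^esub> pure_tensor K M N x' y"
    using ring_hom_add[OF I.rcos_ring_hom c(1,2)] by (simp add: pure_tensor_def tensor_def)
  finally show ?thesis .
qed

lemma pure_tensor_left_hom:
  assumes "algebra K M" "algebra K N"
  shows "(\<lambda>x. pure_tensor K M N x \<one>\<^bsub>N\<^esub>) \<in> ring_hom M (tensor K M N)"
proof -
  interpret M: algebra K M by fact
  interpret N: algebra K N by fact
  interpret I: ideal "tensor_rels K M N" "pair_ring M N"
    by (rule tensor_rels_ideal[OF assms])
  have c: "frag_of (x, \<one>\<^bsub>N\<^esub>) \<in> carrier (pair_ring M N)" if "x \<in> carrier M" for x
    using that by (auto simp: pair_ring_simps)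
  show ?thesis
  proof (rule ring_hom_memI)
    fix x assume "x \<in> carrier M"
    then show "pure_tensor K M N x \<one>\<^bsub>N\<^esub> \<in> carrier (tensor K M N)"
      unfolding pure_tensor_def tensor_def by (intro ring_hom_closed[OF I.rcos_ring_hom] c)
  next
    fix x x' assume "x \<in> carrier M" "x' \<in> carrier M"
    then show "pure_tensor K M N (x \<otimes>\<^bsub>M\<^esub> x') \<one>\<^bsub>N\<^esub> =
        pure_tensor K M N x \<one>\<^bsub>N\<^esub> \<otimes>\<^bsub>tensor K M N\<^esub> pure_tensor K M N x' \<one>\<^bsub>N\<^esub>"
      using ring_hom_mult[OF I.rcos_ring_hom c c, of x x']
      by (simp add: pure_tensor_def tensor_def pair_ring_simps(2))
  next
    show "pure_tensor K M N \<one>\<^bsub>M\<^esub> \<one>\<^bsub>N\<^esub> = \<one>\<^bsub>tensor K M N\<^esub>"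
      using ring_hom_one[OF I.rcos_ring_hom]
      by (simp add: pure_tensor_def tensor_def pair_ring_simps(3))
  qed (use pure_tensor_add_left[OF assms] in simp)
qed

text \<open>
  The map \<open>f \<otimes> g\<close> into \<open>tensor K M' N'\<close>. The union ranges over the representatives of the
  class \<open>U\<close>; for \<open>f\<close> and \<open>g\<close> homomorphisms of algebras all its members are the same coset.
\<close>

definition tensor_map ::
    "('a, 'k) ring_scheme \<Rightarrow> ('a, 'm2, 'p) module_scheme \<Rightarrow> ('a, 'n2, 'q) module_scheme \<Rightarrow>
      ('m1 \<Rightarrow> 'm2) \<Rightarrow> ('n1 \<Rightarrow> 'n2) \<Rightarrow>
      ('m1 \<times> 'n1 \<Rightarrow>\<^sub>0 int) set \<Rightarrow> ('m2 \<times> 'n2 \<Rightarrow>\<^sub>0 int) set"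
  where "tensor_map K M' N' f g U =
    (\<Union>u\<in>U. tensor_rels K M' N' +>\<^bsub>pair_ring M' N'\<^esub>
      frag_extend (\<lambda>(x, y). frag_of (f x, g y)) u)"


lemma frag_extend_pair_closed:
  assumes f: "f \<in> ring_hom M M'" and g: "g \<in> ring_hom N N'"
    and u: "u \<in> carrier (pair_ring M N)"
  shows "frag_extend (\<lambda>(x, y). frag_of (f x, g y)) u \<in> carrier (pair_ring M' N')"
proof -
  have "Poly_Mapping.keys u \<subseteq> carrier M \<times> carrier N"
    using u by (simp add: pair_ring_simps)
  then have "Poly_Mapping.keys (frag_extend (\<lambda>(x, y). frag_of (f x, g y)) u)
      \<subseteq> carrier M' \<times> carrier N'"
  proof (induction u rule: frag_induction)
    case (one a)
    then show ?case
      by (cases a) (simp add: ring_hom_closed[OF f] ring_hom_closed[OF g])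
  qed (simp_all add: frag_extend_diff keys_diff_subset)
  then show ?thesis by (simp add: pair_ring_simps)
qed

lemma tensor_map_coset:
  assumes "algebra K M" "algebra K N" "algebra K M'" "algebra K N'"
    and f: "f \<in> ring_hom M M'" and g: "g \<in> ring_hom N N'"
    and f_lin: "\<forall>a\<in>carrier K. \<forall>x\<in>carrier M. f (a \<odot>\<^bsub>M\<^esub> x) = a \<odot>\<^bsub>M'\<^esub> f x"
    and g_lin: "\<forall>a\<in>carrier K. \<forall>y\<in>carrier N. g (a \<odot>\<^bsub>N\<^esub> y) = a \<odot>\<^bsub>N'\<^esub> g y"
    and u: "u \<in> carrier (pair_ring M N)"
  shows "tensor_map K M' N' f g (tensor_rels K M N +>\<^bsub>pair_ring M N\<^esub> u) =
    tensor_rels K M' N' +>\<^bsub>pair_ring M' N'\<^esub> frag_extend (\<lambda>(x, y). frag_of (f x, g y)) u"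
proof -
  let ?\<phi> = "frag_extend (\<lambda>(x, y). frag_of (f x, g y))"
  interpret I: ideal "tensor_rels K M N" "pair_ring M N"
    by (rule tensor_rels_ideal[OF assms(1,2)])
  have rels: "?\<phi> v \<in> tensor_rels K M' N'" if "v \<in> tensor_rels K M N" for v
    using assms(1,2) that
  proof (induction v rule: tensor_rels_induct)
    case (gen v)
    then have "?\<phi> v \<in> tensor_gens K M' N'"
    proof (cases rule: tensor_gensE)
      case (add_left x x' y)
      then show ?thesis
        using tensor_gensI(1)[of "f x" M' "f x'" "g y" N' K] ring_hom_closed[OF f] ring_hom_closed[OF g]
        by (simp add: frag_extend_diff ring_hom_add[OF f])
    next
      case (add_right x y y')
      then show ?thesis
        using tensor_gensI(2)[of "f x" M' "g y" N' "g y'" K] ring_hom_closed[OF f] ring_hom_closed[OF g]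
        by (simp add: frag_extend_diff ring_hom_add[OF g])
    next
      case (balance a x y)
      then show ?thesis
        using tensor_gensI(3)[of a K "f x" M' "g y" N'] ring_hom_closed[OF f] ring_hom_closed[OF g]
        by (simp add: frag_extend_diff f_lin g_lin)
    qed
    then show ?case unfolding tensor_rels_def by (rule generate.incl)
  qed (simp_all add: frag_extend_diff tensor_rels_zero tensor_rels_diff[OF assms(3,4)])
  have closed: "?\<phi> v \<in> carrier (pair_ring M' N')" if "v \<in> carrier (pair_ring M N)" for v
    using frag_extend_pair_closed[OF f g that] .
  have "tensor_rels K M' N' +>\<^bsub>pair_ring M' N'\<^esub> ?\<phi> v =
      tensor_rels K M' N' +>\<^bsub>pair_ring M' N'\<^esub> ?\<phi> u"
    if v_mem: "v \<in> tensor_rels K M N +>\<^bsub>pair_ring M N\<^esub> u" for v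
  proof -
    obtain h where h: "h \<in> tensor_rels K M N" and v: "v = h + u"
      using v_mem unfolding a_r_coset_def' pair_ring_simps(5) by blast
    have v_carr: "v \<in> carrier (pair_ring M N)"
      using I.a_r_coset_subset_G[OF I.a_subset u] v_mem by blast
    then show ?thesis
      using rels[OF h]
      by (intro tensor_proj_eqI[OF assms(3,4) _ closed[OF v_carr] closed[OF u]])
        (simp add: v frag_extend_add)
  qed
  moreover have "u \<in> tensor_rels K M N +>\<^bsub>pair_ring M N\<^esub> u"
    using u by (rule I.a_rcos_self)
  ultimately show ?thesis unfolding tensor_map_def by blast
qed

lemma tensor_map_pure_tensor:
  assumes "algebra K M" "algebra K N" "algebra K M'" "algebra K N'"
    and "f \<in> ring_hom M M'" "g \<in> ring_hom N N'"
    and "\<forall>a\<in>carrier K. \<forall>x\<in>carrier M. f (a \<odot>\<^bsub>M\<^esub> x) = a \<odot>\<^bsub>M'\<^esub> f x"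
    and "\<forall>a\<in>carrier K. \<forall>y\<in>carrier N. g (a \<odot>\<^bsub>N\<^esub> y) = a \<odot>\<^bsub>N'\<^esub> g y"
    and "x \<in> carrier M" "y \<in> carrier N"
  shows "tensor_map K M' N' f g (pure_tensor K M N x y) = pure_tensor K M' N' (f x) (g y)"
  unfolding pure_tensor_def
  using tensor_map_coset[OF assms(1-8), of "frag_of (x, y)"] assms(9,10)
  by (simp add: pair_ring_simps)

lemma tensor_map_hom:
  assumes "algebra K M" "algebra K N" "algebra K M'" "algebra K N'"
    and f: "f \<in> ring_hom M M'" and g: "g \<in> ring_hom N N'"
    and "\<forall>a\<in>carrier K. \<forall>x\<in>carrier M. f (a \<odot>\<^bsub>M\<^esub> x) = a \<odot>\<^bsub>M'\<^esub> f x"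
    and "\<forall>a\<in>carrier K. \<forall>y\<in>carrier N. g (a \<odot>\<^bsub>N\<^esub> y) = a \<odot>\<^bsub>N'\<^esub> g y"
  shows "tensor_map K M' N' f g \<in> ring_hom (tensor K M N) (tensor K M' N')"
proof -
  let ?\<phi> = "frag_extend (\<lambda>(x, y). frag_of (f x, g y))"
  interpret I: ideal "tensor_rels K M N" "pair_ring M N"
    by (rule tensor_rels_ideal[OF assms(1,2)])
  interpret I': ideal "tensor_rels K M' N'" "pair_ring M' N'"
    by (rule tensor_rels_ideal[OF assms(3,4)])
  note coset = tensor_map_coset[OF assms]
  have closed: "?\<phi> v \<in> carrier (pair_ring M' N')" if "v \<in> carrier (pair_ring M N)" for v
    using frag_extend_pair_closed[OF f g that] .
  have mult: "?\<phi> (frag_mult M N u v) = frag_mult M' N' (?\<phi> u) (?\<phi> v)"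
    if u: "Poly_Mapping.keys u \<subseteq> carrier M \<times> carrier N"
      and v: "Poly_Mapping.keys v \<subseteq> carrier M \<times> carrier N" for u v
    using u
  proof (induction u rule: frag_induction)
    case (one a)
    show ?case
      using v
    proof (induction v rule: frag_induction)
      case (one c)
      then show ?case using \<open>a \<in> carrier M \<times> carrier N\<close>
        by (cases a; cases c) (auto simp: ring_hom_mult[OF f] ring_hom_mult[OF g])
    qed (simp_all add: frag_mult_diff_right frag_extend_diff)
  qed (simp_all add: frag_mult_diff_left frag_extend_diff)
  have rep: "\<exists>u\<in>carrier (pair_ring M N). U = tensor_rels K M N +>\<^bsub>pair_ring M N\<^esub> u"
    if "U \<in> carrier (tensor K M N)" for U
    using that by (auto simp: tensor_def FactRing_def A_RCOSETS_def')
  have proj: "tensor_rels K M N +>\<^bsub>pair_ring M N\<^esub> \<one>\<^bsub>pair_ring M N\<^esub> = \<one>\<^bsub>tensor K M N\<^esub>"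
    "tensor_rels K M' N' +>\<^bsub>pair_ring M' N'\<^esub> \<one>\<^bsub>pair_ring M' N'\<^esub> = \<one>\<^bsub>tensor K M' N'\<^esub>"
    by (simp_all add: tensor_def FactRing_def)
  show ?thesis
  proof (rule ring_hom_memI)
    fix U assume "U \<in> carrier (tensor K M N)"
    then obtain u where u: "u \<in> carrier (pair_ring M N)"
      "U = tensor_rels K M N +>\<^bsub>pair_ring M N\<^esub> u" using rep by blast
    show "tensor_map K M' N' f g U \<in> carrier (tensor K M' N')"
      using ring_hom_closed[OF I'.rcos_ring_hom closed[OF u(1)]]
      by (simp add: u coset tensor_def)
  next
    fix U V assume "U \<in> carrier (tensor K M N)" "V \<in> carrier (tensor K M N)"
    then obtain u v where u: "u \<in> carrier (pair_ring M N)"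
      "U = tensor_rels K M N +>\<^bsub>pair_ring M N\<^esub> u" and v: "v \<in> carrier (pair_ring M N)"
      "V = tensor_rels K M N +>\<^bsub>pair_ring M N\<^esub> v" using rep by meson
    have "U \<otimes>\<^bsub>tensor K M N\<^esub> V = tensor_rels K M N +>\<^bsub>pair_ring M N\<^esub> (u \<otimes>\<^bsub>pair_ring M N\<^esub> v)"
      using ring_hom_mult[OF I.rcos_ring_hom u(1) v(1)] by (simp add: u v tensor_def)
    then show "tensor_map K M' N' f g (U \<otimes>\<^bsub>tensor K M N\<^esub> V) =
        tensor_map K M' N' f g U \<otimes>\<^bsub>tensor K M' N'\<^esub> tensor_map K M' N' f g V"
      using ring_hom_mult[OF I'.rcos_ring_hom closed[OF u(1)] closed[OF v(1)]] u(1) v(1)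
        coset[OF I.m_closed[OF u(1) v(1)]]
      by (simp add: u(2) v(2) coset mult tensor_def pair_ring_simps)
    have "U \<oplus>\<^bsub>tensor K M N\<^esub> V = tensor_rels K M N +>\<^bsub>pair_ring M N\<^esub> (u \<oplus>\<^bsub>pair_ring M N\<^esub> v)"
      using ring_hom_add[OF I.rcos_ring_hom u(1) v(1)] by (simp add: u v tensor_def)
    then show "tensor_map K M' N' f g (U \<oplus>\<^bsub>tensor K M N\<^esub> V) =
        tensor_map K M' N' f g U \<oplus>\<^bsub>tensor K M' N'\<^esub> tensor_map K M' N' f g V"
      using ring_hom_add[OF I'.rcos_ring_hom closed[OF u(1)] closed[OF v(1)]] u(1) v(1)
        coset[OF I.add.m_closed[OF u(1) v(1)]]
      by (simp add: u(2) v(2) coset frag_extend_add tensor_def pair_ring_simps)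
  next
    show "tensor_map K M' N' f g \<one>\<^bsub>tensor K M N\<^esub> = \<one>\<^bsub>tensor K M' N'\<^esub>"
      unfolding proj(1)[symmetric] coset[OF I.one_closed] proj(2)[symmetric]
      by (simp add: pair_ring_simps ring_hom_one[OF f] ring_hom_one[OF g])
  qed
qed


section \<open>Derivations and biderivations\<close>

text \<open>
  Only the values on the carrier matter. No linearity over a base ring is required.
\<close>

definition derivation ::
    "('r, 'k) ring_scheme \<Rightarrow> ('r, 'm, 'p) module_scheme \<Rightarrow> ('r \<Rightarrow> 'm) \<Rightarrow> bool"
  where "derivation R M d \<longleftrightarrow>
    d \<in> carrier R \<rightarrow> carrier M \<and>
    (\<forall>x\<in>carrier R. \<forall>y\<in>carrier R. d (x \<oplus>\<^bsub>R\<^esub> y) = d x \<oplus>\<^bsub>M\<^esub> d y) \<and>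
    (\<forall>x\<in>carrier R. \<forall>y\<in>carrier R. d (x \<otimes>\<^bsub>R\<^esub> y) = x \<odot>\<^bsub>M\<^esub> d y \<oplus>\<^bsub>M\<^esub> y \<odot>\<^bsub>M\<^esub> d x)"

definition biderivation ::
    "('r, 'k) ring_scheme \<Rightarrow> ('r, 'm, 'p) module_scheme \<Rightarrow> ('r \<Rightarrow> 'r \<Rightarrow> 'm) \<Rightarrow> bool"
  where "biderivation R M \<beta> \<longleftrightarrow>
    (\<forall>r\<in>carrier R. derivation R M (\<lambda>x. \<beta> r x) \<and> derivation R M (\<lambda>x. \<beta> x r))"

definition extends_along ::
    "('r, 'k) ring_scheme \<Rightarrow> ('r \<Rightarrow> 's) \<Rightarrow> ('s \<Rightarrow> 's \<Rightarrow> 'm) \<Rightarrow> ('r \<Rightarrow> 'r \<Rightarrow> 'm) \<Rightarrow> bool"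
  where "extends_along R \<iota> \<gamma> \<beta> \<longleftrightarrow>
    (\<forall>r\<in>carrier R. \<forall>s\<in>carrier R. \<gamma> (\<iota> r) (\<iota> s) = \<beta> r s)"

end

theory Submission
  imports Defs
begin

text \<open>
  Write \<open>P = R \<otimes> A[b]\<close> and \<open>T = R \<otimes> B\<close>. The ring \<open>P\<close> is generated by \<open>R\<close> and \<open>b\<close>, and since \<open>b\<close> is
  transcendental, a derivation \<open>P \<rightarrow> T\<close> is the same as a derivation \<open>R \<rightarrow> T\<close> together with an
  arbitrary value at \<open>b\<close>. For \<open>r \<in> R\<close> let \<open>L\<^sub>r : P \<rightarrow> T\<close> be the derivation extending \<open>\<beta>(r, \<cdot>)\<close> with
  \<open>L\<^sub>r(b) = D(r)\<close>. For \<open>y \<in> P\<close> the map \<open>r \<mapsto> L\<^sub>r(y)\<close> is a derivation, because this holds for the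
  generators \<open>y\<close> and is inherited by sums and products; let \<open>\<gamma>(\<cdot>, y)\<close> be its extension to \<open>P\<close> with
  value \<open>E(y)\<close> at \<open>b\<close>. The same argument shows that \<open>\<gamma>\<close> is a derivation in \<open>y\<close>.
\<close>

section \<open>Derivations along a homomorphism\<close>

lemma derivation_along_iff:
  "derivation S (scalars_along f T) d \<longleftrightarrow>
    d \<in> carrier S \<rightarrow> carrier T \<and>
    (\<forall>x\<in>carrier S. \<forall>y\<in>carrier S. d (x \<oplus>\<^bsub>S\<^esub> y) = d x \<oplus>\<^bsub>T\<^esub> d y) \<and>
    (\<forall>x\<in>carrier S. \<forall>y\<in>carrier S. d (x \<otimes>\<^bsub>S\<^esub> y) = f x \<otimes>\<^bsub>T\<^esub> d y \<oplus>\<^bsub>T\<^esub> f y \<otimes>\<^bsub>T\<^esub> d x)"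
  by (simp add: derivation_def)

lemma derivation_alongI:
  assumes "\<And>x. x \<in> carrier S \<Longrightarrow> d x \<in> carrier T"
    and "\<And>x y. x \<in> carrier S \<Longrightarrow> y \<in> carrier S \<Longrightarrow> d (x \<oplus>\<^bsub>S\<^esub> y) = d x \<oplus>\<^bsub>T\<^esub> d y"
    and "\<And>x y. x \<in> carrier S \<Longrightarrow> y \<in> carrier S \<Longrightarrow>
      d (x \<otimes>\<^bsub>S\<^esub> y) = f x \<otimes>\<^bsub>T\<^esub> d y \<oplus>\<^bsub>T\<^esub> f y \<otimes>\<^bsub>T\<^esub> d x"
  shows "derivation S (scalars_along f T) d"
  using assms by (auto simp: derivation_along_iff)

lemma derivation_alongD:
  assumes "derivation S (scalars_along f T) d" and "x \<in> carrier S"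
  shows "d x \<in> carrier T"
    and "y \<in> carrier S \<Longrightarrow> d (x \<oplus>\<^bsub>S\<^esub> y) = d x \<oplus>\<^bsub>T\<^esub> d y"
    and "y \<in> carrier S \<Longrightarrow> d (x \<otimes>\<^bsub>S\<^esub> y) = f x \<otimes>\<^bsub>T\<^esub> d y \<oplus>\<^bsub>T\<^esub> f y \<otimes>\<^bsub>T\<^esub> d x"
  using assms by (auto simp: derivation_along_iff)

lemma derivation_along_cong:
  assumes "ring S"
    and "\<And>x. x \<in> carrier S \<Longrightarrow> f x = f' x" and "\<And>x. x \<in> carrier S \<Longrightarrow> d x = d' x"
  shows "derivation S (scalars_along f T) d \<longleftrightarrow> derivation S (scalars_along f' T) d'"
proof -
  interpret ring S by fact
  show ?thesis
    by (auto simp: derivation_along_iff assms(2,3) Pi_iff)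
qed

lemma derivation_along_comp:
  assumes h: "h \<in> ring_hom S' S" and d: "derivation S (scalars_along f T) d"
  shows "derivation S' (scalars_along (\<lambda>x. f (h x)) T) (\<lambda>x. d (h x))"
  by (rule derivation_alongI)
    (simp_all add: ring_hom_closed[OF h] ring_hom_add[OF h] ring_hom_mult[OF h] derivation_alongD[OF d])

text \<open>Commutativity of \<open>T\<close> lets the constants pass the factors \<open>f x\<close>
  of the Leibniz rule. Two coefficients cover what \<open>derivation_along_family\<close> needs:
  negation, sums, and the right-hand side of the Leibniz rule itself.\<close>

lemma derivation_along_lincomb:
  assumes "cring T" and f: "f \<in> carrier S \<rightarrow> carrier T"
    and c: "c \<in> carrier T" "c' \<in> carrier T"
    and d: "derivation S (scalars_along f T) d" and d': "derivation S (scalars_along f T) d'"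
  shows "derivation S (scalars_along f T) (\<lambda>x. c \<otimes>\<^bsub>T\<^esub> d x \<oplus>\<^bsub>T\<^esub> c' \<otimes>\<^bsub>T\<^esub> d' x)"
proof -
  interpret T: cring T by fact
  have f: "f x \<in> carrier T" if "x \<in> carrier S" for x
    using f that by blast
  show ?thesis
  proof (rule derivation_alongI)
    fix x y assume x: "x \<in> carrier S" and y: "y \<in> carrier S"
    note xy = f[OF x] f[OF y] derivation_alongD(1)[OF d x] derivation_alongD(1)[OF d y]
      derivation_alongD(1)[OF d' x] derivation_alongD(1)[OF d' y]
    show "c \<otimes>\<^bsub>T\<^esub> d (x \<oplus>\<^bsub>S\<^esub> y) \<oplus>\<^bsub>T\<^esub> c' \<otimes>\<^bsub>T\<^esub> d' (x \<oplus>\<^bsub>S\<^esub> y) =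
        c \<otimes>\<^bsub>T\<^esub> d x \<oplus>\<^bsub>T\<^esub> c' \<otimes>\<^bsub>T\<^esub> d' x \<oplus>\<^bsub>T\<^esub> (c \<otimes>\<^bsub>T\<^esub> d y \<oplus>\<^bsub>T\<^esub> c' \<otimes>\<^bsub>T\<^esub> d' y)"
      unfolding derivation_alongD(2)[OF d x y] derivation_alongD(2)[OF d' x y]
      using xy c by (simp add: T.r_distr T.a_ac)
    show "c \<otimes>\<^bsub>T\<^esub> d (x \<otimes>\<^bsub>S\<^esub> y) \<oplus>\<^bsub>T\<^esub> c' \<otimes>\<^bsub>T\<^esub> d' (x \<otimes>\<^bsub>S\<^esub> y) =
        f x \<otimes>\<^bsub>T\<^esub> (c \<otimes>\<^bsub>T\<^esub> d y \<oplus>\<^bsub>T\<^esub> c' \<otimes>\<^bsub>T\<^esub> d' y) \<oplus>\<^bsub>T\<^esub>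
        f y \<otimes>\<^bsub>T\<^esub> (c \<otimes>\<^bsub>T\<^esub> d x \<oplus>\<^bsub>T\<^esub> c' \<otimes>\<^bsub>T\<^esub> d' x)"
      unfolding derivation_alongD(3)[OF d x y] derivation_alongD(3)[OF d' x y]
      using xy c by (simp add: T.r_distr T.a_ac T.m_ac)
  qed (use c in \<open>simp add: derivation_alongD(1)[OF d] derivation_alongD(1)[OF d']\<close>)
qed

lemma derivation_along_one:
  assumes "ring S" "cring T" and f: "f \<in> ring_hom S T"
    and d: "derivation S (scalars_along f T) d"
  shows "d \<one>\<^bsub>S\<^esub> = \<zero>\<^bsub>T\<^esub>"
proof -
  interpret S: ring S by fact
  interpret T: cring T by fact
  have "d \<one>\<^bsub>S\<^esub> = d \<one>\<^bsub>S\<^esub> \<oplus>\<^bsub>T\<^esub> d \<one>\<^bsub>S\<^esub>"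
    using derivation_alongD(3)[OF d S.one_closed S.one_closed] derivation_alongD(1)[OF d S.one_closed]
    by (simp add: ring_hom_one[OF f])
  then show ?thesis
    using derivation_alongD(1)[OF d S.one_closed] by (metis T.add.r_cancel_one')
qed

lemma derivation_along_zero:
  assumes "ring S" "cring T" and d: "derivation S (scalars_along f T) d"
  shows "d \<zero>\<^bsub>S\<^esub> = \<zero>\<^bsub>T\<^esub>"
proof -
  interpret S: ring S by fact
  interpret T: cring T by fact
  have "d \<zero>\<^bsub>S\<^esub> = d \<zero>\<^bsub>S\<^esub> \<oplus>\<^bsub>T\<^esub> d \<zero>\<^bsub>S\<^esub>"
    using derivation_alongD(2)[OF d S.zero_closed S.zero_closed] by simp
  then show ?thesis
    using derivation_alongD(1)[OF d S.zero_closed] by (metis T.add.r_cancel_one')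
qed

lemma derivation_along_minus:
  assumes "ring S" "cring T" and d: "derivation S (scalars_along f T) d" and x: "x \<in> carrier S"
  shows "d (\<ominus>\<^bsub>S\<^esub> x) = \<ominus>\<^bsub>T\<^esub> d x"
proof -
  interpret S: ring S by fact
  interpret T: cring T by fact
  have "d (\<ominus>\<^bsub>S\<^esub> x) \<oplus>\<^bsub>T\<^esub> d x = \<zero>\<^bsub>T\<^esub>"
    using derivation_alongD(2)[OF d S.a_inv_closed[OF x] x] derivation_along_zero[OF assms(1-3)] x
    by (simp add: S.l_neg)
  then show ?thesis
    using derivation_alongD(1)[OF d] x by (intro T.minus_equality[symmetric]) simp_all
qed

text \<open>The rules at 1 and for negation, sums and products carry agreement from the generators
  to everything they generate. This is the source of uniqueness, applied in each argument of a
  biderivation.\<close>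

lemma derivation_along_eq_on_generate_ring:
  assumes "ring S" "cring T" and f: "f \<in> ring_hom S T"
    and d: "derivation S (scalars_along f T) d" and d': "derivation S (scalars_along f T) d'"
    and G: "G \<subseteq> carrier S" and eq: "\<And>g. g \<in> G \<Longrightarrow> d g = d' g"
    and x: "x \<in> generate_ring S G"
  shows "d x = d' x"
  using x
proof (induction rule: generate_ring.induct)
  case one
  show ?case by (simp add: derivation_along_one[OF assms(1-3) d] derivation_along_one[OF assms(1-3) d'])
next
  case (a_inv h)
  then show ?case
    using ring.generate_ring_in_carrier[OF assms(1) G]
    by (simp add: derivation_along_minus[OF assms(1,2) d] derivation_along_minus[OF assms(1,2) d'])
next
  case (eng_add h1 h2)
  then show ?case
    using derivation_alongD(2)[OF d] derivation_alongD(2)[OF d'] ring.generate_ring_in_carrier[OF assms(1) G]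
    by simp
next
  case (eng_mult h1 h2)
  then show ?case
    using derivation_alongD(3)[OF d] derivation_alongD(3)[OF d'] ring.generate_ring_in_carrier[OF assms(1) G]
    by simp
qed (rule eq)

text \<open>Each ring operation in \<open>y\<close> turns \<open>F r y\<close> into a
  \<open>T\<close>-linear combination of earlier values whose coefficients do not depend on
  \<open>r\<close>, and such combinations of derivations in \<open>r\<close> are derivations. It
  serves once for each argument of the biderivation under construction.\<close>

lemma derivation_along_family:
  assumes "ring S" "ring P" "cring T" and f: "f \<in> carrier S \<rightarrow> carrier T" and g: "g \<in> ring_hom P T"
    and F: "\<And>r. r \<in> carrier S \<Longrightarrow> derivation P (scalars_along g T) (F r)"
    and G: "G \<subseteq> carrier P" "\<And>u. u \<in> G \<Longrightarrow> derivation S (scalars_along f T) (\<lambda>r. F r u)"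
    and y: "y \<in> generate_ring P G"
  shows "derivation S (scalars_along f T) (\<lambda>r. F r y)"
proof -
  interpret T: cring T by fact
  have g': "g u \<in> carrier T" if "u \<in> carrier P" for u
    using ring_hom_closed[OF g that] .
  have cong: "derivation S (scalars_along f T) d \<Longrightarrow> (\<And>r. r \<in> carrier S \<Longrightarrow> d' r = d r) \<Longrightarrow>
      derivation S (scalars_along f T) d'" for d d'
    using derivation_along_cong[OF assms(1), of f f d d' T] by simp
  note carr = ring.generate_ring_in_carrier[OF assms(2) G(1)]
  note lin = derivation_along_lincomb[OF assms(3) f]
  show ?thesis
    using y
  proof (induction rule: generate_ring.induct)
    case one
    \<comment> \<open>Every \<open>F r\<close> vanishes at 1, so the map to be treated here is
      zero.\<close>
    have "derivation S (scalars_along f T) (\<lambda>r. \<zero>\<^bsub>T\<^esub>)"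
      by (rule derivation_alongI) (use f in \<open>auto simp: Pi_iff\<close>)
    then show ?case
      by (rule cong) (rule derivation_along_one[OF assms(2,3) g F])
  next
    case (a_inv h)
    \<comment> \<open>Negation is the combination with coefficients -1 and 0; the same derivation is
      repeated as a dummy second term.\<close>
    show ?case
      by (rule cong[OF lin[of "\<ominus>\<^bsub>T\<^esub> \<one>\<^bsub>T\<^esub>" "\<zero>\<^bsub>T\<^esub>", OF _ _ a_inv.IH a_inv.IH]])
        (simp_all add: derivation_along_minus[OF assms(2,3) F] carr[OF a_inv.hyps]
          derivation_alongD(1)[OF F] T.l_minus)
  next
    case (eng_add h1 h2)
    show ?case
      by (rule cong[OF lin[of "\<one>\<^bsub>T\<^esub>" "\<one>\<^bsub>T\<^esub>", OF _ _ eng_add.IH]])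
        (simp_all add: derivation_alongD[OF F] carr eng_add.hyps)
  next
    case (eng_mult h1 h2)
    \<comment> \<open>The Leibniz rule pairs \<open>g h1\<close> with the value at \<open>h2\<close>
      and \<open>g h2\<close> with the value at \<open>h1\<close>, hence the exchanged induction
      hypotheses.\<close>
    show ?case
      by (rule cong[OF lin[of "g h1" "g h2", OF _ _ eng_mult.IH(2,1)]])
        (simp_all add: derivation_alongD[OF F] carr g' eng_mult.hyps)
  qed (rule G(2))
qed

text \<open>The tensor product enters only through two properties of \<open>P\<close>:
  \<open>gen\<close>, which yields uniqueness and propagation from generators, and
  \<open>ext\<close>, which extends a derivation on \<open>S\<close> with a freely chosen value at
  \<open>b\<close>.\<close>

lemma biderivation_extension:
  assumes "ring S" "ring P" "cring T" and g: "g \<in> ring_hom P T" and \<iota>: "\<iota> \<in> ring_hom S P"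
    and b: "b \<in> carrier P" and gen: "carrier P = generate_ring P (insert b (\<iota> ` carrier S))"
    and ext: "\<And>\<delta> t. derivation S (scalars_along (\<lambda>r. g (\<iota> r)) T) \<delta> \<Longrightarrow> t \<in> carrier T \<Longrightarrow>
      \<exists>d. derivation P (scalars_along g T) d \<and> (\<forall>r\<in>carrier S. d (\<iota> r) = \<delta> r) \<and> d b = t"
    and D: "derivation S (scalars_along (\<lambda>r. g (\<iota> r)) T) D"
    and E: "derivation P (scalars_along g T) E"
    and \<beta>: "biderivation S (scalars_along (\<lambda>r. g (\<iota> r)) T) \<beta>"
  shows "\<exists>\<gamma>.
    (biderivation P (scalars_along g T) \<gamma> \<and> extends_along S \<iota> \<gamma> \<beta> \<and>
      (\<forall>r\<in>carrier S. \<gamma> (\<iota> r) b = D r) \<and> (\<forall>x\<in>carrier P. \<gamma> b x = E x)) \<and>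
    (\<forall>\<gamma>'.
      biderivation P (scalars_along g T) \<gamma>' \<and> extends_along S \<iota> \<gamma>' \<beta> \<and>
      (\<forall>r\<in>carrier S. \<gamma>' (\<iota> r) b = D r) \<and> (\<forall>x\<in>carrier P. \<gamma>' b x = E x) \<longrightarrow>
      (\<forall>x\<in>carrier P. \<forall>y\<in>carrier P. \<gamma>' x y = \<gamma> x y))"
proof -
  let ?T\<^sub>S = "scalars_along (\<lambda>r. g (\<iota> r)) T" and ?T\<^sub>P = "scalars_along g T"
  let ?G = "insert b (\<iota> ` carrier S)"
  have \<iota>_closed: "\<iota> r \<in> carrier P" if "r \<in> carrier S" for r
    using ring_hom_closed[OF \<iota> that] .
  have G: "?G \<subseteq> carrier P"
    using b \<iota>_closed by blast
  have g_closed: "g \<in> carrier P \<rightarrow> carrier T" "(\<lambda>r. g (\<iota> r)) \<in> carrier S \<rightarrow> carrier T"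
    using ring_hom_closed[OF g] \<iota>_closed by auto
  note unique = derivation_along_eq_on_generate_ring[OF assms(2,3) g _ _ G, folded gen]
  \<comment> \<open>A choice of the extension supplied by \<open>ext\<close>; for admissible data
    \<open>unique\<close> forces its values on the carrier of \<open>P\<close>.\<close>
  define lift where "lift \<delta> t = (SOME d. derivation P ?T\<^sub>P d \<and> (\<forall>r\<in>carrier S. d (\<iota> r) = \<delta> r) \<and> d b = t)"
    for \<delta> t
  have lift: "derivation P ?T\<^sub>P (lift \<delta> t)" "r \<in> carrier S \<Longrightarrow> lift \<delta> t (\<iota> r) = \<delta> r" "lift \<delta> t b = t"
    if "derivation S ?T\<^sub>S \<delta>" "t \<in> carrier T" for \<delta> t r
    using someI_ex[OF ext[OF that]] unfolding lift_def by blast+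
  have \<beta>1: "derivation S ?T\<^sub>S (\<beta> r)" and \<beta>2: "derivation S ?T\<^sub>S (\<lambda>s. \<beta> s r)"
    if "r \<in> carrier S" for r
    using \<beta> that unfolding biderivation_def by simp_all
  note D_closed = derivation_alongD(1)[OF D] and E_closed = derivation_alongD(1)[OF E]
  \<comment> \<open>The value \<open>D r\<close> at \<open>b\<close> builds in condition
    (i).\<close>
  define L where "L r = lift (\<beta> r) (D r)" for r
  have L: "derivation P ?T\<^sub>P (L r)" "L r b = D r" if "r \<in> carrier S" for r
    unfolding L_def using lift[OF \<beta>1[OF that] D_closed[OF that]] by blast+
  have L_\<iota>: "L r (\<iota> s) = \<beta> r s" if "r \<in> carrier S" "s \<in> carrier S" for r s
    unfolding L_def using lift(2)[OF \<beta>1 D_closed] that by blast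
  have L': "derivation S ?T\<^sub>S (\<lambda>r. L r y)" if "y \<in> carrier P" for y
  proof (rule derivation_along_family[OF assms(1-3) g_closed(2) g L(1) G])
    \<comment> \<open>At \<open>u = b\<close> the family is \<open>D\<close>; at
      \<open>u = \<iota> s\<close> it is \<open>\<lambda>r. \<beta> r s\<close>.\<close>
    fix u assume "u \<in> ?G"
    then consider "u = b" | s where "s \<in> carrier S" "u = \<iota> s" by blast
    then show "derivation S ?T\<^sub>S (\<lambda>r. L r u)"
    proof cases
      case 1
      then show ?thesis
        using D by (subst derivation_along_cong[OF assms(1), where f' = "\<lambda>r. g (\<iota> r)" and d' = D])
          (simp_all add: L(2))
    next
      case 2
      then show ?thesis
        using \<beta>2[of s]
        by (subst derivation_along_cong[OF assms(1), where f' = "\<lambda>r. g (\<iota> r)" and d' = "\<lambda>r. \<beta> r s"])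
          (simp_all add: L_\<iota>)
    qed
  qed (use that gen in auto)
  \<comment> \<open>Now the first argument is extended, with \<open>y\<close> as a parameter; the
    value \<open>E y\<close> at \<open>b\<close> builds in condition (ii).\<close>
  define \<gamma> where "\<gamma> x y = lift (\<lambda>r. L r y) (E y) x" for x y
  have \<gamma>2: "derivation P ?T\<^sub>P (\<lambda>x. \<gamma> x y)" "\<gamma> b y = E y" if "y \<in> carrier P" for y
    unfolding \<gamma>_def using lift[OF L'[OF that] E_closed[OF that]] by simp_all
  have \<gamma>_\<iota>: "\<gamma> (\<iota> r) y = L r y" if "r \<in> carrier S" "y \<in> carrier P" for r y
    unfolding \<gamma>_def using lift(2)[OF L' E_closed] that by blast
  \<comment> \<open>The roles are exchanged: the family is indexed by the second argument and the
    induction runs over the first. At the generators it is \<open>E\<close> or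
    \<open>L s\<close>.\<close>
  have \<gamma>1: "derivation P ?T\<^sub>P (\<gamma> x)" if "x \<in> carrier P" for x
  proof (rule derivation_along_family[OF assms(2,2,3) g_closed(1) g \<gamma>2(1) G])
    fix u assume "u \<in> ?G"
    then consider "u = b" | s where "s \<in> carrier S" "u = \<iota> s" by blast
    then show "derivation P ?T\<^sub>P (\<gamma> u)"
    proof cases
      case 1
      then show ?thesis
        using E by (subst derivation_along_cong[OF assms(2), where f' = g and d' = E])
          (simp_all add: \<gamma>2(2))
    next
      case 2
      then show ?thesis
        using L(1)[of s]
        by (subst derivation_along_cong[OF assms(2), where f' = g and d' = "L s"])
          (simp_all add: \<gamma>_\<iota>)
    qed
  qed (use that gen in auto)
  have "\<gamma>' x y = \<gamma> x y"
    if \<gamma>': "biderivation P ?T\<^sub>P \<gamma>'" and ex: "extends_along S \<iota> \<gamma>' \<beta>"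
      and D': "\<forall>r\<in>carrier S. \<gamma>' (\<iota> r) b = D r" and E': "\<forall>x\<in>carrier P. \<gamma>' b x = E x"
      and x: "x \<in> carrier P" and y: "y \<in> carrier P" for \<gamma>' x y
  proof -
    have \<gamma>'1: "derivation P ?T\<^sub>P (\<gamma>' u)" and \<gamma>'2: "derivation P ?T\<^sub>P (\<lambda>v. \<gamma>' v u)"
      if "u \<in> carrier P" for u
      using \<gamma>' that unfolding biderivation_def by simp_all
    \<comment> \<open>With the first argument in the image of \<open>S\<close>, both sides are
      prescribed on the generators of the second, by \<beta> and by \<open>D\<close>.\<close>
    have \<iota>: "\<gamma>' (\<iota> r) y = \<gamma> (\<iota> r) y" if r: "r \<in> carrier S" for r
    proof (rule unique[OF \<gamma>'1 \<gamma>1 _ y])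
      fix u assume "u \<in> ?G"
      then show "\<gamma>' (\<iota> r) u = \<gamma> (\<iota> r) u"
        using D' ex r by (auto simp: \<gamma>_\<iota> \<iota>_closed b L L_\<iota> extends_along_def)
    qed (use \<iota>_closed r in auto)
    show ?thesis
      \<comment> \<open>With \<open>y\<close> fixed, the generators of the first argument are
        covered by the preceding fact and by \<open>E'\<close>.\<close>
      by (rule unique[OF \<gamma>'2[OF y] \<gamma>2(1)[OF y] _ x]) (use \<iota> E' y \<gamma>2(2) in auto)
  qed
  moreover have "biderivation P ?T\<^sub>P \<gamma>"
    unfolding biderivation_def using \<gamma>1 \<gamma>2(1) by blast
  moreover have "extends_along S \<iota> \<gamma> \<beta>"
    unfolding extends_along_def by (simp add: \<gamma>_\<iota> \<iota>_closed L_\<iota>)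
  moreover have "\<forall>r\<in>carrier S. \<gamma> (\<iota> r) b = D r"
    by (simp add: \<gamma>_\<iota> b L)
  ultimately show ?thesis
    using \<gamma>2(2) by blast
qed

section \<open>Maps out of a tensor product\<close>

lemma tensor_rep:
  assumes "U \<in> carrier (tensor K M N)"
  obtains u where "u \<in> carrier (pair_ring M N)" "U = tensor_rels K M N +>\<^bsub>pair_ring M N\<^esub> u"
  using assms by (auto simp: tensor_def FactRing_def A_RCOSETS_def')

lemma tensor_proj_hom:
  assumes "algebra K M" "algebra K N"
  shows "(+>\<^bsub>pair_ring M N\<^esub>) (tensor_rels K M N) \<in> ring_hom (pair_ring M N) (tensor K M N)"
  unfolding tensor_def by (rule ideal.rcos_ring_hom[OF tensor_rels_ideal[OF assms]])

lemma pure_tensor_closed: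
  assumes "algebra K M" "algebra K N" "x \<in> carrier M" "y \<in> carrier N"
  shows "pure_tensor K M N x y \<in> carrier (tensor K M N)"
  unfolding pure_tensor_def
  by (rule ring_hom_closed[OF tensor_proj_hom[OF assms(1,2)]]) (use assms in \<open>simp add: pair_ring_simps\<close>)

lemma pure_tensor_mult:
  assumes "algebra K M" "algebra K N" "x \<in> carrier M" "x' \<in> carrier M" "y \<in> carrier N" "y' \<in> carrier N"
  shows "pure_tensor K M N x y \<otimes>\<^bsub>tensor K M N\<^esub> pure_tensor K M N x' y' =
    pure_tensor K M N (x \<otimes>\<^bsub>M\<^esub> x') (y \<otimes>\<^bsub>N\<^esub> y')"
  using ring_hom_mult[OF tensor_proj_hom[OF assms(1,2)], of "frag_of (x, y)" "frag_of (x', y')"] assms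
  by (simp add: pure_tensor_def pair_ring_simps)

lemma pure_tensor_one:
  assumes "algebra K M" "algebra K N"
  shows "pure_tensor K M N \<one>\<^bsub>M\<^esub> \<one>\<^bsub>N\<^esub> = \<one>\<^bsub>tensor K M N\<^esub>"
  by (rule ring_hom_one[OF pure_tensor_left_hom[OF assms]])

lemma pure_tensor_add_right:
  assumes "algebra K M" "algebra K N" "x \<in> carrier M" "y \<in> carrier N" "y' \<in> carrier N"
  shows "pure_tensor K M N x (y \<oplus>\<^bsub>N\<^esub> y') =
    pure_tensor K M N x y \<oplus>\<^bsub>tensor K M N\<^esub> pure_tensor K M N x y'"
proof -
  interpret N: algebra K N by fact
  interpret Q: cring "pair_ring M N"
    by (intro pair_ring_cring algebra.axioms(2)[OF assms(1)] algebra.axioms(2)[OF assms(2)])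
  have c: "frag_of (x, y) \<in> carrier (pair_ring M N)" "frag_of (x, y') \<in> carrier (pair_ring M N)"
    "frag_of (x, y \<oplus>\<^bsub>N\<^esub> y') \<in> carrier (pair_ring M N)"
    using assms by (auto simp: pair_ring_simps)
  have "frag_of (x, y \<oplus>\<^bsub>N\<^esub> y') - (frag_of (x, y) \<oplus>\<^bsub>pair_ring M N\<^esub> frag_of (x, y')) \<in> tensor_rels K M N"
    unfolding tensor_rels_def
    using tensor_gensI(2)[OF assms(3-5), of K] by (intro generate.incl) (simp add: pair_ring_simps diff_diff_eq)
  then have "pure_tensor K M N x (y \<oplus>\<^bsub>N\<^esub> y') =
      tensor_rels K M N +>\<^bsub>pair_ring M N\<^esub> (frag_of (x, y) \<oplus>\<^bsub>pair_ring M N\<^esub> frag_of (x, y'))"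
    unfolding pure_tensor_def by (rule tensor_proj_eqI[OF assms(1,2) _ c(3) Q.add.m_closed[OF c(1,2)]])
  also have "\<dots> = pure_tensor K M N x y \<oplus>\<^bsub>tensor K M N\<^esub> pure_tensor K M N x y'"
    unfolding pure_tensor_def by (rule ring_hom_add[OF tensor_proj_hom[OF assms(1,2)] c(1,2)])
  finally show ?thesis .
qed

lemma pure_tensor_balance:
  assumes "algebra K M" "algebra K N" "a \<in> carrier K" "x \<in> carrier M" "y \<in> carrier N"
  shows "pure_tensor K M N (a \<odot>\<^bsub>M\<^esub> x) y = pure_tensor K M N x (a \<odot>\<^bsub>N\<^esub> y)"
proof -
  interpret M: algebra K M by fact
  interpret N: algebra K N by fact
  show ?thesis
    unfolding pure_tensor_def
  proof (rule tensor_proj_eqI[OF assms(1,2)])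
    show "frag_of (a \<odot>\<^bsub>M\<^esub> x, y) - frag_of (x, a \<odot>\<^bsub>N\<^esub> y) \<in> tensor_rels K M N"
      unfolding tensor_rels_def by (rule generate.incl[OF tensor_gensI(3)[OF assms(3-5)]])
  qed (use assms in \<open>simp_all add: pair_ring_simps\<close>)
qed

lemma pure_tensor_right_hom:
  assumes "algebra K M" "algebra K N"
  shows "(\<lambda>y. pure_tensor K M N \<one>\<^bsub>M\<^esub> y) \<in> ring_hom N (tensor K M N)"
proof -
  interpret M: algebra K M by fact
  interpret N: algebra K N by fact
  show ?thesis
    by (rule ring_hom_memI)
      (simp_all add: pure_tensor_closed[OF assms] pure_tensor_mult[OF assms]
        pure_tensor_add_right[OF assms] pure_tensor_one[OF assms])
qed

text \<open>The free abelian group is reached from its basis by differences, so one closure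
  condition serves for sums, negatives and zero.\<close>

lemma tensor_induct [consumes 3, case_names pure diff]:
  assumes "algebra K M" "algebra K N" and U: "U \<in> carrier (tensor K M N)"
    and pure: "\<And>x y. x \<in> carrier M \<Longrightarrow> y \<in> carrier N \<Longrightarrow> Q (pure_tensor K M N x y)"
    and diff: "\<And>U V. U \<in> carrier (tensor K M N) \<Longrightarrow> V \<in> carrier (tensor K M N) \<Longrightarrow> Q U \<Longrightarrow> Q V \<Longrightarrow>
      Q (U \<ominus>\<^bsub>tensor K M N\<^esub> V)"
  shows "Q U"
proof -
  interpret M: algebra K M by fact
  interpret N: algebra K N by fact
  interpret T: cring "tensor K M N" by (rule tensor_cring[OF assms(1,2)])
  interpret Q: cring "pair_ring M N"
    by (intro pair_ring_cring algebra.axioms(2)[OF assms(1)] algebra.axioms(2)[OF assms(2)])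
  let ?p = "(+>\<^bsub>pair_ring M N\<^esub>) (tensor_rels K M N)"
  interpret p: ring_hom_cring "pair_ring M N" "tensor K M N" ?p
    by (intro ring_hom_cringI Q.cring_axioms T.cring_axioms tensor_proj_hom[OF assms(1,2)])
  obtain u where u: "u \<in> carrier (pair_ring M N)" "U = ?p u"
    using U by (rule tensor_rep)
  have "Poly_Mapping.keys u \<subseteq> carrier M \<times> carrier N"
    using u(1) by (simp add: pair_ring_simps)
  \<comment> \<open>Membership is carried along because additivity of the projection is available
    only on the carrier.\<close>
  then have "u \<in> carrier (pair_ring M N) \<and> Q (?p u)"
  proof (induction u rule: frag_induction)
    case zero
    have c: "\<zero>\<^bsub>M\<^esub> \<in> carrier M" "\<zero>\<^bsub>N\<^esub> \<in> carrier N"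
      by simp_all
    note z = pure_tensor_closed[OF assms(1,2) c]
    \<comment> \<open>No hypothesis covers zero, so it is written as a pure tensor minus
      itself.\<close>
    have "?p 0 = pure_tensor K M N \<zero>\<^bsub>M\<^esub> \<zero>\<^bsub>N\<^esub> \<ominus>\<^bsub>tensor K M N\<^esub> pure_tensor K M N \<zero>\<^bsub>M\<^esub> \<zero>\<^bsub>N\<^esub>"
      using p.hom_zero z by (simp add: pair_ring_simps(4) T.r_neg T.minus_eq)
    then show ?case
      using diff[OF z z pure[OF c] pure[OF c]] by (simp add: pair_ring_simps)
  next
    case (one a)
    then show ?case
      using pure by (cases a) (auto simp: pure_tensor_def pair_ring_simps)
  next
    case (diff u v)
    then have u: "u \<in> carrier (pair_ring M N)" and v: "v \<in> carrier (pair_ring M N)"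
      by simp_all
    have uv: "u - v \<in> carrier (pair_ring M N)"
      using keys_diff_subset u v by (simp add: pair_ring_simps)
    have "?p u = ?p ((u - v) \<oplus>\<^bsub>pair_ring M N\<^esub> v)"
      by (simp add: pair_ring_simps(5))
    also have "\<dots> = ?p (u - v) \<oplus>\<^bsub>tensor K M N\<^esub> ?p v"
      by (rule p.hom_add[OF uv v])
    finally have "?p (u - v) = ?p u \<ominus>\<^bsub>tensor K M N\<^esub> ?p v"
      using p.hom_closed[OF uv] p.hom_closed[OF v] by (simp add: T.minus_eq T.a_assoc T.r_neg)
    then show ?case
      using assms(5)[OF p.hom_closed[OF u] p.hom_closed[OF v]] diff uv by simp
  qed
  then show ?thesis using u(2) by simp
qed

text \<open>The target is a bare abelian group because derivations need not be
  \<open>K\<close>-linear; only balancing over \<open>K\<close> is asked. The extension of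
  \<open>h\<close> to the free abelian group kills the defining relations.\<close>

lemma tensor_additive_lift:
  assumes "algebra K M" "algebra K N" "abelian_group G"
    and closed: "\<And>x y. x \<in> carrier M \<Longrightarrow> y \<in> carrier N \<Longrightarrow> h x y \<in> carrier G"
    and add_left: "\<And>x x' y. x \<in> carrier M \<Longrightarrow> x' \<in> carrier M \<Longrightarrow> y \<in> carrier N \<Longrightarrow>
      h (x \<oplus>\<^bsub>M\<^esub> x') y = h x y \<oplus>\<^bsub>G\<^esub> h x' y"
    and add_right: "\<And>x y y'. x \<in> carrier M \<Longrightarrow> y \<in> carrier N \<Longrightarrow> y' \<in> carrier N \<Longrightarrow>
      h x (y \<oplus>\<^bsub>N\<^esub> y') = h x y \<oplus>\<^bsub>G\<^esub> h x y'"
    and balance: "\<And>a x y. a \<in> carrier K \<Longrightarrow> x \<in> carrier M \<Longrightarrow> y \<in> carrier N \<Longrightarrow>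
      h (a \<odot>\<^bsub>M\<^esub> x) y = h x (a \<odot>\<^bsub>N\<^esub> y)"
  obtains d where "\<And>U. U \<in> carrier (tensor K M N) \<Longrightarrow> d U \<in> carrier G"
    and "\<And>U V. U \<in> carrier (tensor K M N) \<Longrightarrow> V \<in> carrier (tensor K M N) \<Longrightarrow>
      d (U \<oplus>\<^bsub>tensor K M N\<^esub> V) = d U \<oplus>\<^bsub>G\<^esub> d V"
    and "\<And>x y. x \<in> carrier M \<Longrightarrow> y \<in> carrier N \<Longrightarrow> d (pure_tensor K M N x y) = h x y"
proof -
  interpret M: algebra K M by fact
  interpret N: algebra K N by fact
  interpret G: abelian_group G by fact
  interpret I: ideal "tensor_rels K M N" "pair_ring M N"
    by (rule tensor_rels_ideal[OF assms(1,2)])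
  let ?S = "carrier M \<times> carrier N"
  let ?p = "(+>\<^bsub>pair_ring M N\<^esub>) (tensor_rels K M N)"
  have "case_prod h ` ?S \<subseteq> carrier (add_monoid G)"
    using closed by auto
  then obtain H where hom: "H \<in> hom (free_Abelian_group ?S) (add_monoid G)"
    and H_of: "\<And>c. c \<in> ?S \<Longrightarrow> H (frag_of c) = case_prod h c"
    using comm_group.free_Abelian_group_universal[OF G.a_comm_group] by blast
  have H_closed: "H u \<in> carrier G" if "u \<in> carrier (pair_ring M N)" for u
    using hom_in_carrier[OF hom, of u] that by (simp add: pair_ring_simps)
  have H_add: "H (u + v) = H u \<oplus>\<^bsub>G\<^esub> H v"
    if "u \<in> carrier (pair_ring M N)" "v \<in> carrier (pair_ring M N)" for u v
    using hom_mult[OF hom, of u v] that by (simp add: pair_ring_simps)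
  have diff_closed: "u - v \<in> carrier (pair_ring M N)"
    if "u \<in> carrier (pair_ring M N)" "v \<in> carrier (pair_ring M N)" for u v
    using keys_diff_subset that by (simp add: pair_ring_simps)
  have H_diff: "H (u - v) = H u \<ominus>\<^bsub>G\<^esub> H v"
    if "u \<in> carrier (pair_ring M N)" "v \<in> carrier (pair_ring M N)" for u v
    using H_add[OF diff_closed[OF that] that(2)] H_closed[OF that(2)] H_closed[OF diff_closed[OF that]]
    by (simp add: G.minus_eq G.a_assoc G.r_neg)
  have of_closed: "frag_of (x, y) \<in> carrier (pair_ring M N)" if "x \<in> carrier M" "y \<in> carrier N" for x y
    using that by (simp add: pair_ring_simps)
  \<comment> \<open>Biadditivity and balance of \<open>h\<close> annihilate the three kinds of
    generators, and differences pass this on to the whole subgroup.\<close>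
  have rels: "u \<in> carrier (pair_ring M N) \<and> H u = \<zero>\<^bsub>G\<^esub>" if "u \<in> tensor_rels K M N" for u
    using assms(1,2) that
  proof (induction u rule: tensor_rels_induct)
    case zero
    have "H (0 - 0) = \<zero>\<^bsub>G\<^esub>"
      using H_diff[of 0 0] H_closed[of 0] by (simp add: pair_ring_simps G.minus_eq G.r_neg)
    then show ?case by (simp add: pair_ring_simps)
  next
    case (gen u)
    then show ?case
    proof (cases rule: tensor_gensE)
      case (add_left x x' y)
      then show ?thesis
        by (simp add: diff_closed of_closed H_diff H_of assms(5) closed G.minus_eq G.a_ac
          G.r_neg G.r_neg1 G.r_neg2)
    next
      case (add_right x y y')
      then show ?thesis
        by (simp add: diff_closed of_closed H_diff H_of assms(6) closed G.minus_eq G.a_ac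
          G.r_neg G.r_neg1 G.r_neg2)
    next
      case (balance a x y)
      then show ?thesis
        by (simp add: diff_closed of_closed H_diff H_of assms(7) closed G.minus_eq G.r_neg)
    qed
  next
    case (diff u v)
    then show ?case by (simp add: diff_closed H_diff G.minus_eq)
  qed
  \<comment> \<open>An arbitrary representative is evaluated; two representatives differ by a
    relation, which \<open>H\<close> kills.\<close>
  define d where "d U = H (SOME u. u \<in> U)" for U
  have d_proj: "d (?p u) = H u" if u: "u \<in> carrier (pair_ring M N)" for u
  proof -
    have "(SOME v. v \<in> ?p u) \<in> ?p u"
      using I.a_rcos_self[OF u] by (rule someI)
    then obtain v where v: "v \<in> tensor_rels K M N" "(SOME v. v \<in> ?p u) = v + u"
      unfolding a_r_coset_def' pair_ring_simps(5) by blast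
    show ?thesis
      unfolding d_def v(2) using rels[OF v(1)] u by (simp add: H_add H_closed)
  qed
  show thesis
  proof (rule that)
    fix U assume "U \<in> carrier (tensor K M N)"
    then show "d U \<in> carrier G" by (elim tensor_rep) (simp add: d_proj H_closed)
  next
    fix U V assume "U \<in> carrier (tensor K M N)" "V \<in> carrier (tensor K M N)"
    then obtain u v where u: "u \<in> carrier (pair_ring M N)" "U = ?p u"
      and v: "v \<in> carrier (pair_ring M N)" "V = ?p v"
      using tensor_rep by metis
    have "U \<oplus>\<^bsub>tensor K M N\<^esub> V = ?p (u \<oplus>\<^bsub>pair_ring M N\<^esub> v)"
      unfolding u(2) v(2) by (rule ring_hom_add[OF tensor_proj_hom[OF assms(1,2)] u(1) v(1), symmetric])
    then show "d (U \<oplus>\<^bsub>tensor K M N\<^esub> V) = d U \<oplus>\<^bsub>G\<^esub> d V"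
      using d_proj[OF I.a_closed[OF u(1) v(1)]] u v by (simp add: d_proj H_add pair_ring_simps(5))
  next
    fix x y assume "x \<in> carrier M" "y \<in> carrier N"
    then show "d (pure_tensor K M N x y) = h x y"
      unfolding pure_tensor_def by (simp add: d_proj of_closed H_of)
  qed
qed

text \<open>
  The witness is \<open>x \<otimes> y \<mapsto> x e(y) + y \<delta>(x)\<close>; it is balanced over \<open>K\<close> because \<open>\<delta>\<close> and \<open>e\<close> agree
  on the images of \<open>K\<close>.
\<close>

lemma tensor_derivation:
  assumes "algebra K M" "algebra K N" "cring T" and \<phi>: "\<phi> \<in> ring_hom (tensor K M N) T"
    and \<delta>: "derivation M (scalars_along (\<lambda>x. \<phi> (pure_tensor K M N x \<one>\<^bsub>N\<^esub>)) T) \<delta>"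
    and e: "derivation N (scalars_along (\<lambda>y. \<phi> (pure_tensor K M N \<one>\<^bsub>M\<^esub> y)) T) e"
    and agree: "\<And>a. a \<in> carrier K \<Longrightarrow> \<delta> (a \<odot>\<^bsub>M\<^esub> \<one>\<^bsub>M\<^esub>) = e (a \<odot>\<^bsub>N\<^esub> \<one>\<^bsub>N\<^esub>)"
  shows "\<exists>d. derivation (tensor K M N) (scalars_along \<phi> T) d \<and>
    (\<forall>x\<in>carrier M. d (pure_tensor K M N x \<one>\<^bsub>N\<^esub>) = \<delta> x) \<and>
    (\<forall>y\<in>carrier N. d (pure_tensor K M N \<one>\<^bsub>M\<^esub> y) = e y)"
proof -
  interpret M: algebra K M by fact
  interpret N: algebra K N by fact
  interpret T: cring T by fact
  interpret P: cring "tensor K M N" by (rule tensor_cring[OF assms(1,2)])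
  interpret \<phi>: ring_hom_cring "tensor K M N" T \<phi>
    by (intro ring_hom_cringI P.cring_axioms T.cring_axioms \<phi>)
  have MR: "ring M" and NR: "ring N"
    using algebra.axioms(2)[OF assms(1)] algebra.axioms(2)[OF assms(2)] by (simp_all add: cring_def)
  interpret MC: cring M by (rule algebra.axioms(2)[OF assms(1)])
  interpret NC: cring N by (rule algebra.axioms(2)[OF assms(2)])
  define f where "f x = \<phi> (pure_tensor K M N x \<one>\<^bsub>N\<^esub>)" for x
  define g where "g y = \<phi> (pure_tensor K M N \<one>\<^bsub>M\<^esub> y)" for y
  have fh: "f \<in> ring_hom M T"
    using ring_hom_trans[OF pure_tensor_left_hom[OF assms(1,2)] \<phi>] by (simp add: f_def[abs_def] comp_def)
  have gh: "g \<in> ring_hom N T"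
    using ring_hom_trans[OF pure_tensor_right_hom[OF assms(1,2)] \<phi>] by (simp add: g_def[abs_def] comp_def)
  note f = ring_hom_closed[OF fh] ring_hom_add[OF fh] ring_hom_mult[OF fh]
  note g = ring_hom_closed[OF gh] ring_hom_add[OF gh] ring_hom_mult[OF gh]
  have \<phi>_pure: "\<phi> (pure_tensor K M N x y) = f x \<otimes>\<^bsub>T\<^esub> g y" if "x \<in> carrier M" "y \<in> carrier N" for x y
    using that \<phi>.hom_mult[of "pure_tensor K M N x \<one>\<^bsub>N\<^esub>" "pure_tensor K M N \<one>\<^bsub>M\<^esub> y"]
    by (simp add: f_def g_def pure_tensor_mult[OF assms(1,2)] pure_tensor_closed[OF assms(1,2)])
  note \<delta>' = derivation_alongD[OF \<delta>[folded f_def[abs_def]]]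
  note e' = derivation_alongD[OF e[folded g_def[abs_def]]]
  have \<delta>1: "\<delta> \<one>\<^bsub>M\<^esub> = \<zero>\<^bsub>T\<^esub>"
    by (rule derivation_along_one[OF MR assms(3) fh \<delta>[folded f_def[abs_def]]])
  have e1: "e \<one>\<^bsub>N\<^esub> = \<zero>\<^bsub>T\<^esub>"
    by (rule derivation_along_one[OF NR assms(3) gh e[folded g_def[abs_def]]])
  define h where "h x y = f x \<otimes>\<^bsub>T\<^esub> e y \<oplus>\<^bsub>T\<^esub> g y \<otimes>\<^bsub>T\<^esub> \<delta> x" for x y
  have h_balance: "h (a \<odot>\<^bsub>M\<^esub> x) y = h x (a \<odot>\<^bsub>N\<^esub> y)"
    if a: "a \<in> carrier K" and x: "x \<in> carrier M" and y: "y \<in> carrier N" for a x y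
  proof -
    let ?m = "a \<odot>\<^bsub>M\<^esub> \<one>\<^bsub>M\<^esub>" and ?n = "a \<odot>\<^bsub>N\<^esub> \<one>\<^bsub>N\<^esub>"
    have m: "?m \<in> carrier M" and n: "?n \<in> carrier N"
      using a by simp_all
    \<comment> \<open>Scalars become multiplication by the images of \<open>a\<close>, so the
      Leibniz rule applies on both sides of the balance; \<open>fg\<close> and \<open>agree\<close>
      then match the terms.\<close>
    have ax: "a \<odot>\<^bsub>M\<^esub> x = ?m \<otimes>\<^bsub>M\<^esub> x" and ay: "a \<odot>\<^bsub>N\<^esub> y = ?n \<otimes>\<^bsub>N\<^esub> y"
      using a x y by (simp_all add: M.smult_assoc2 N.smult_assoc2)
    have fg: "f ?m = g ?n"
      unfolding f_def g_def using pure_tensor_balance[OF assms(1,2) a] by simp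
    show ?thesis
      unfolding h_def ax ay \<delta>'(3)[OF m x] e'(3)[OF n y] f(3)[OF m x] g(3)[OF n y] fg agree[OF a]
      using f(1)[OF x] g(1)[OF y] g(1)[OF n] \<delta>'(1)[OF x] e'(1)[OF y] e'(1)[OF n]
      by (simp add: T.r_distr T.l_distr T.a_ac T.m_ac)
  qed
  obtain d where d_closed: "\<And>U. U \<in> carrier (tensor K M N) \<Longrightarrow> d U \<in> carrier T"
    and d_add: "\<And>U V. U \<in> carrier (tensor K M N) \<Longrightarrow> V \<in> carrier (tensor K M N) \<Longrightarrow>
      d (U \<oplus>\<^bsub>tensor K M N\<^esub> V) = d U \<oplus>\<^bsub>T\<^esub> d V"
    and d_pure: "\<And>x y. x \<in> carrier M \<Longrightarrow> y \<in> carrier N \<Longrightarrow> d (pure_tensor K M N x y) = h x y"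
  proof (rule tensor_additive_lift[OF assms(1,2) T.abelian_group_axioms, of h])
    show "h x y \<in> carrier T" if "x \<in> carrier M" "y \<in> carrier N" for x y
      unfolding h_def using that by (simp add: f g \<delta>' e')
    show "h (x \<oplus>\<^bsub>M\<^esub> x') y = h x y \<oplus>\<^bsub>T\<^esub> h x' y"
      if "x \<in> carrier M" "x' \<in> carrier M" "y \<in> carrier N" for x x' y
      unfolding h_def using that by (simp add: f g \<delta>' e' T.r_distr T.l_distr T.a_ac)
    show "h x (y \<oplus>\<^bsub>N\<^esub> y') = h x y \<oplus>\<^bsub>T\<^esub> h x y'"
      if "x \<in> carrier M" "y \<in> carrier N" "y' \<in> carrier N" for x y y'
      unfolding h_def using that by (simp add: f g \<delta>' e' T.r_distr T.l_distr T.a_ac)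
  qed (use h_balance in auto)
  \<comment> \<open>Differences are the operation on which \<open>tensor_induct\<close>
    runs.\<close>
  have d_diff: "d (U \<ominus>\<^bsub>tensor K M N\<^esub> V) = d U \<ominus>\<^bsub>T\<^esub> d V"
    if U: "U \<in> carrier (tensor K M N)" and V: "V \<in> carrier (tensor K M N)" for U V
  proof -
    have UV: "U \<ominus>\<^bsub>tensor K M N\<^esub> V \<in> carrier (tensor K M N)"
      using U V by simp
    have "(U \<ominus>\<^bsub>tensor K M N\<^esub> V) \<oplus>\<^bsub>tensor K M N\<^esub> V = U"
      using U V by (simp add: P.minus_eq P.a_assoc P.l_neg)
    then have "d U = d (U \<ominus>\<^bsub>tensor K M N\<^esub> V) \<oplus>\<^bsub>T\<^esub> d V"
      using d_add[OF UV V] by simp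
    then show ?thesis
      using d_closed[OF UV] d_closed[OF V] by (simp add: T.minus_eq T.a_assoc T.r_neg)
  qed
  have d_pure_mult: "d (pure_tensor K M N x y \<otimes>\<^bsub>tensor K M N\<^esub> pure_tensor K M N x' y') =
      \<phi> (pure_tensor K M N x y) \<otimes>\<^bsub>T\<^esub> d (pure_tensor K M N x' y') \<oplus>\<^bsub>T\<^esub>
      \<phi> (pure_tensor K M N x' y') \<otimes>\<^bsub>T\<^esub> d (pure_tensor K M N x y)"
    if c: "x \<in> carrier M" "y \<in> carrier N" "x' \<in> carrier M" "y' \<in> carrier N" for x y x' y'
    using c unfolding pure_tensor_mult[OF assms(1,2) c(1,3,2,4)]
    by (simp add: d_pure \<phi>_pure h_def f g \<delta>' e' T.r_distr T.l_distr T.a_ac T.m_ac)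
  \<comment> \<open>Both sides are additive in each factor, so two nested inductions reduce the
    Leibniz rule to pure tensors.\<close>
  have d_mult: "d (U \<otimes>\<^bsub>tensor K M N\<^esub> V) = \<phi> U \<otimes>\<^bsub>T\<^esub> d V \<oplus>\<^bsub>T\<^esub> \<phi> V \<otimes>\<^bsub>T\<^esub> d U"
    if U: "U \<in> carrier (tensor K M N)" and V: "V \<in> carrier (tensor K M N)" for U V
    using assms(1,2) U
  proof (induction U rule: tensor_induct)
    case (pure x y)
    note xy = pure_tensor_closed[OF assms(1,2) pure]
    show ?case
      using assms(1,2) V
    proof (induction V rule: tensor_induct)
      case (pure x' y')
      then show ?case using d_pure_mult \<open>x \<in> carrier M\<close> \<open>y \<in> carrier N\<close> by blast
    next
      case (diff V W)
      then show ?case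
        using xy
        by (simp add: P.minus_eq P.r_distr P.r_minus)
          (simp add: P.minus_eq[symmetric] d_diff d_closed T.minus_eq T.r_distr T.l_distr T.r_minus T.l_minus
            T.minus_add T.a_ac)
    qed
  next
    case (diff U W)
    then show ?case
      using V
      by (simp add: P.minus_eq P.l_distr P.l_minus)
        (simp add: P.minus_eq[symmetric] d_diff d_closed T.minus_eq T.r_distr T.l_distr T.r_minus T.l_minus
          T.minus_add T.a_ac)
  qed
  have "derivation (tensor K M N) (scalars_along \<phi> T) d"
    by (rule derivation_alongI) (fact d_closed d_add d_mult)+
  \<comment> \<open>In \<open>h x 1\<close> the summand with \<open>e 1\<close> vanishes and
    \<open>g 1 = 1\<close>.\<close>
  moreover have "d (pure_tensor K M N x \<one>\<^bsub>N\<^esub>) = \<delta> x" if "x \<in> carrier M" for x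
    using that by (simp add: d_pure h_def e1 f \<delta>' ring_hom_one[OF gh])
  moreover have "d (pure_tensor K M N \<one>\<^bsub>M\<^esub> y) = e y" if "y \<in> carrier N" for y
    using that by (simp add: d_pure h_def \<delta>1 g e' ring_hom_one[OF fh])
  ultimately show ?thesis by blast
qed

section \<open>Simple transcendental extensions\<close>

lemma (in cring) simple_extension_add:
  assumes A: "subring A R" and b: "b \<in> carrier R"
    and y: "y \<in> simple_extension A b" and z: "z \<in> simple_extension A b"
  shows "y \<oplus> z \<in> simple_extension A b"
  using y z
proof (induction arbitrary: z rule: simple_extension.induct)
  case zero
  then show ?case
    using simple_extension_in_carrier[OF subringE(1)[OF A] b] by auto
next
  case (lin q k)
  note carr = subsetD[OF simple_extension_in_carrier[OF subringE(1)[OF A] b]] subsetD[OF subringE(1)[OF A]]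
  from lin(4) show ?case
  proof cases
    case zero
    then show ?thesis
      using simple_extension.lin[OF lin(1,2)] carr b lin(1,2) by simp
  next
    case (lin q' k')
    \<comment> \<open>Heads and constants are added separately; the induction hypothesis is used at
      \<open>q'\<close>, hence the arbitrary \<open>z\<close>.\<close>
    have "q \<otimes> b \<oplus> k \<oplus> z = (q \<oplus> q') \<otimes> b \<oplus> (k \<oplus> k')"
      using lin \<open>q \<in> simple_extension A b\<close> \<open>k \<in> A\<close> carr b by (simp add: l_distr a_ac)
    then show ?thesis
      using simple_extension.lin[OF lin.IH[OF lin(2)]] subringE(7)[OF A] lin \<open>k \<in> A\<close> by simp
  qed
qed

lemma (in cring) simple_extension_smult:
  assumes A: "subring A R" and b: "b \<in> carrier R"
    and k: "k \<in> A" and y: "y \<in> simple_extension A b"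
  shows "k \<otimes> y \<in> simple_extension A b"
  using y
proof (induction rule: simple_extension.induct)
  case zero
  then show ?case using k subringE(1)[OF A] by auto
next
  case (lin q c)
  note carr = subsetD[OF simple_extension_in_carrier[OF subringE(1)[OF A] b]] subsetD[OF subringE(1)[OF A]]
  have "k \<otimes> (q \<otimes> b \<oplus> c) = (k \<otimes> q) \<otimes> b \<oplus> k \<otimes> c"
    using lin carr b k by (simp add: r_distr m_assoc)
  then show ?case
    using simple_extension.lin[OF lin.IH] subringE(6)[OF A k lin(2)] by simp
qed

lemma (in cring) simple_extension_mult:
  assumes A: "subring A R" and b: "b \<in> carrier R"
    and y: "y \<in> simple_extension A b" and z: "z \<in> simple_extension A b"
  shows "y \<otimes> z \<in> simple_extension A b"
  using y
proof (induction rule: simple_extension.induct)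
  case zero
  then show ?case
    using simple_extension_in_carrier[OF subringE(1)[OF A] b] z by auto
next
  case (lin q k)
  note carr = subsetD[OF simple_extension_in_carrier[OF subringE(1)[OF A] b]] subsetD[OF subringE(1)[OF A]]
  \<comment> \<open>The added zero puts the first summand into Horner form with constant term
    0.\<close>
  have "(q \<otimes> b \<oplus> k) \<otimes> z = ((q \<otimes> z) \<otimes> b \<oplus> \<zero>) \<oplus> k \<otimes> z"
    using lin carr b z by (simp add: l_distr r_distr m_ac)
  then show ?case
    using simple_extension_add[OF A b simple_extension.lin[OF lin.IH subringE(2)[OF A]]]
      simple_extension_smult[OF A b lin(2) z] by simp
qed

lemma (in cring) simple_extension_subring:
  assumes A: "subring A R" and b: "b \<in> carrier R"
  shows "subring (simple_extension A b) R"
proof (rule subringI)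
  show carr: "simple_extension A b \<subseteq> carrier R"
    by (rule simple_extension_in_carrier[OF subringE(1)[OF A] b])
  show "\<one> \<in> simple_extension A b"
    using simple_extension_incl[OF subringE(1)[OF A] b] subringE(3)[OF A] by blast
  fix y assume y: "y \<in> simple_extension A b"
  have "(\<ominus> \<one>) \<otimes> y \<in> simple_extension A b"
    by (rule simple_extension_smult[OF A b subringE(5)[OF A subringE(3)[OF A]] y])
  then show "\<ominus> y \<in> simple_extension A b"
    using y carr by (auto simp: l_minus)
next
  fix y z assume "y \<in> simple_extension A b" "z \<in> simple_extension A b"
  then show "y \<otimes> z \<in> simple_extension A b" "y \<oplus> z \<in> simple_extension A b"
    using simple_extension_mult[OF A b] simple_extension_add[OF A b] by blast+
qed

text \<open>Transcendence is injectivity of evaluation at \<open>b\<close> on polynomials over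
  \<open>A\<close>. Coefficients are listed from the leading one down, so if \<open>p\<close>
  evaluates to \<open>q\<close>, then \<open>p @ [k]\<close> evaluates to
  \<open>q \<otimes> b \<oplus> k\<close>; comparing coefficients recovers \<open>k\<close> and
  \<open>p\<close>.\<close>

lemma (in ring) transcendental_decomp_unique:
  assumes A: "subring A R" and b: "b \<in> carrier R" and tr: "transcendental A b"
    and q: "q \<in> simple_extension A b" "q' \<in> simple_extension A b" and k: "k \<in> A" "k' \<in> A"
    and eq: "q \<otimes> b \<oplus> k = q' \<otimes> b \<oplus> k'"
  shows "q = q'" and "k = k'"
proof -
  obtain p where p: "polynomial A p" "q = eval p b"
    using q(1) unfolding simple_extension_as_eval_img[OF subringE(1)[OF A] b] univ_poly_carrier[symmetric]
    by (auto simp: univ_poly_carrier)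
  obtain p' where p': "polynomial A p'" "q' = eval p' b"
    using q(2) unfolding simple_extension_as_eval_img[OF subringE(1)[OF A] b]
    by (auto simp: univ_poly_carrier)
  have set: "set p \<subseteq> A" "set p' \<subseteq> A"
    using p(1) p'(1) by (auto dest: polynomial_incl)
  then have carr: "set (p @ [k]) \<subseteq> carrier R" "set (p' @ [k']) \<subseteq> carrier R"
    using k subringE(1)[OF A] by auto
  \<comment> \<open>Normalization is needed because \<open>p = []\<close> with
    \<open>k = \<zero>\<close> would give a list with leading coefficient zero.\<close>
  have "eval (normalize (p @ [k])) b = eval (normalize (p' @ [k'])) b"
    using eq carr b unfolding p(2) p'(2)
    by (simp add: eval_normalize[OF carr(1)] eval_normalize[OF carr(2)] eval_append_aux)
  moreover have "normalize (p @ [k]) \<in> carrier (A[X])" "normalize (p' @ [k']) \<in> carrier (A[X])"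
    using set k by (auto simp: univ_poly_carrier[symmetric] intro!: normalize_gives_polynomial)
  ultimately have "normalize (p @ [k]) = normalize (p' @ [k'])"
    using tr unfolding transcendental_def by (auto dest: inj_onD)
  then have coeff: "coeff (p @ [k]) = coeff (p' @ [k'])"
    by (metis normalize_coeff)
  show "k = k'"
    using fun_cong[OF coeff, of 0] by (simp add: append_coeff)
  have "coeff p = coeff p'"
  proof
    \<comment> \<open>Appending shifts degrees up by one: degree \<open>Suc i\<close> of the longer
      list is degree \<open>i\<close> of \<open>p\<close>.\<close>
    fix i show "coeff p i = coeff p' i"
      using fun_cong[OF coeff, of "Suc i"] by (simp add: append_coeff)
  qed
  then have "p = p'"
    using coeff_iff_polynomial_cond[OF p(1) p'(1)] by blast
  then show "q = q'" using p(2) p'(2) by simp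
qed

text \<open>
  The graph of the derivation of \<open>A[b]\<close> over \<open>g\<close> that extends \<open>\<delta>\<close> and sends \<open>b\<close> to \<open>t\<close>, in Horner form.
  It exists as a relation for every \<open>b\<close>; it is single-valued because \<open>b\<close> is transcendental.
\<close>

inductive derivation_graph ::
    "('b, 'n) ring_scheme \<Rightarrow> 'b set \<Rightarrow> 'b \<Rightarrow> ('t, 'm) ring_scheme \<Rightarrow> ('b \<Rightarrow> 't) \<Rightarrow> ('b \<Rightarrow> 't) \<Rightarrow> 't \<Rightarrow>
      'b \<Rightarrow> 't \<Rightarrow> bool"
  for B A b T g \<delta> t where
    zero: "derivation_graph B A b T g \<delta> t \<zero>\<^bsub>B\<^esub> \<zero>\<^bsub>T\<^esub>"
  | lin: "derivation_graph B A b T g \<delta> t q w \<Longrightarrow> k \<in> A \<Longrightarrow>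
      derivation_graph B A b T g \<delta> t (q \<otimes>\<^bsub>B\<^esub> b \<oplus>\<^bsub>B\<^esub> k) (g b \<otimes>\<^bsub>T\<^esub> w \<oplus>\<^bsub>T\<^esub> g q \<otimes>\<^bsub>T\<^esub> t \<oplus>\<^bsub>T\<^esub> \<delta> k)"

text \<open>The graph obeys the sum and Leibniz rules without transcendence and reaches all of A[b]
  through Horner form. Transcendence makes it a function, which inherits the rules.\<close>

lemma transcendental_derivation:
  assumes "cring B" and A: "subring A B" and b: "b \<in> carrier B" and tr: "ring.transcendental B A b"
    and "cring T" and g: "g \<in> ring_hom (B\<lparr>carrier := ring.simple_extension B A b\<rparr>) T"
    and \<delta>: "derivation (B\<lparr>carrier := A\<rparr>) (scalars_along g T) \<delta>" and t: "t \<in> carrier T"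
  shows "\<exists>e. derivation (B\<lparr>carrier := ring.simple_extension B A b\<rparr>) (scalars_along g T) e \<and>
    (\<forall>a\<in>A. e a = \<delta> a) \<and> e b = t"
proof -
  interpret B: cring B by fact
  interpret T: cring T by fact
  let ?S = "B.simple_extension A b"
  let ?G = "derivation_graph B A b T g \<delta> t"
  have A': "ring (B\<lparr>carrier := A\<rparr>)"
    by (rule B.subring_is_ring[OF A])
  note S = subringE[OF B.simple_extension_subring[OF A b]]
  have S_carr: "y \<in> carrier B" if "y \<in> ?S" for y
    using S(1) that by blast
  have AS: "a \<in> ?S" if "a \<in> A" for a
    using B.simple_extension_incl[OF subringE(1)[OF A] b] that by blast
  have bS: "b \<in> ?S"
    by (rule B.simple_extension_mem[OF A b])
  have g_closed: "g y \<in> carrier T" if "y \<in> ?S" for y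
    using ring_hom_closed[OF g] that by simp
  have g_mult: "g (y \<otimes>\<^bsub>B\<^esub> z) = g y \<otimes>\<^bsub>T\<^esub> g z" and g_add: "g (y \<oplus>\<^bsub>B\<^esub> z) = g y \<oplus>\<^bsub>T\<^esub> g z"
    if "y \<in> ?S" "z \<in> ?S" for y z
    using ring_hom_mult[OF g] ring_hom_add[OF g] that by simp_all
  have g_one: "g \<one>\<^bsub>B\<^esub> = \<one>\<^bsub>T\<^esub>"
    using ring_hom_one[OF g] by simp
  have gA: "g \<in> ring_hom (B\<lparr>carrier := A\<rparr>) T"
    by (rule ring_hom_memI) (simp_all add: g_closed g_mult g_add g_one AS)
  have g_zero: "g \<zero>\<^bsub>B\<^esub> = \<zero>\<^bsub>T\<^esub>"
    using ring_hom_zero[OF gA A'] T.ring_axioms by simp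
  have \<delta>_closed: "\<delta> a \<in> carrier T" if "a \<in> A" for a
    using derivation_alongD(1)[OF \<delta>] that by simp
  have \<delta>_add: "\<delta> (a \<oplus>\<^bsub>B\<^esub> a') = \<delta> a \<oplus>\<^bsub>T\<^esub> \<delta> a'"
    and \<delta>_mult: "\<delta> (a \<otimes>\<^bsub>B\<^esub> a') = g a \<otimes>\<^bsub>T\<^esub> \<delta> a' \<oplus>\<^bsub>T\<^esub> g a' \<otimes>\<^bsub>T\<^esub> \<delta> a" if "a \<in> A" "a' \<in> A" for a a'
    using derivation_alongD(2,3)[OF \<delta>] that by simp_all
  have \<delta>_zero: "\<delta> \<zero>\<^bsub>B\<^esub> = \<zero>\<^bsub>T\<^esub>" and \<delta>_one: "\<delta> \<one>\<^bsub>B\<^esub> = \<zero>\<^bsub>T\<^esub>"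
    using derivation_along_zero[OF A' assms(5) \<delta>] derivation_along_one[OF A' assms(5) gA \<delta>] by simp_all
  have G_closed: "y \<in> ?S \<and> w \<in> carrier T" if "?G y w" for y w
    using that
    by induction (use t in \<open>auto simp: g_closed bS \<delta>_closed intro: B.simple_extension.intros\<close>)
  note closed = S_carr AS g_closed bS \<delta>_closed t S(6,7) subringE(6,7)[OF A]
  have G_add: "?G (y \<oplus>\<^bsub>B\<^esub> y') (w \<oplus>\<^bsub>T\<^esub> w')" if "?G y w" "?G y' w'" for y y' w w'
    using that
  proof (induction arbitrary: y' w' rule: derivation_graph.induct)
    case zero
    then show ?case using G_closed[OF zero] by (simp add: S_carr)
  next
    case (lin q w k)
    note q = lin(1,2) lin.IH G_closed[OF lin(1)]
    from lin(4) show ?case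
    proof cases
      case zero
      then show ?thesis
        using derivation_graph.lin[OF q(1,2)] q by (simp add: closed)
    next
      case (lin q' v k')
      note q' = lin G_closed[OF lin(3)]
      have "q \<otimes>\<^bsub>B\<^esub> b \<oplus>\<^bsub>B\<^esub> k \<oplus>\<^bsub>B\<^esub> y' = (q \<oplus>\<^bsub>B\<^esub> q') \<otimes>\<^bsub>B\<^esub> b \<oplus>\<^bsub>B\<^esub> (k \<oplus>\<^bsub>B\<^esub> k')"
        using q q' by (simp add: closed B.l_distr B.a_ac)
      moreover have "g b \<otimes>\<^bsub>T\<^esub> w \<oplus>\<^bsub>T\<^esub> g q \<otimes>\<^bsub>T\<^esub> t \<oplus>\<^bsub>T\<^esub> \<delta> k \<oplus>\<^bsub>T\<^esub> w' =
          g b \<otimes>\<^bsub>T\<^esub> (w \<oplus>\<^bsub>T\<^esub> v) \<oplus>\<^bsub>T\<^esub> g (q \<oplus>\<^bsub>B\<^esub> q') \<otimes>\<^bsub>T\<^esub> t \<oplus>\<^bsub>T\<^esub> \<delta> (k \<oplus>\<^bsub>B\<^esub> k')"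
        using q q' by (simp add: closed g_add \<delta>_add T.l_distr T.r_distr T.a_ac)
      ultimately show ?thesis
        using derivation_graph.lin[OF q(3)[OF q'(3)]] q(2) q'(4) subringE(7)[OF A] by simp
    qed
  qed
  have G_smult: "?G (c \<otimes>\<^bsub>B\<^esub> y) (g c \<otimes>\<^bsub>T\<^esub> w \<oplus>\<^bsub>T\<^esub> g y \<otimes>\<^bsub>T\<^esub> \<delta> c)" if "?G y w" and c: "c \<in> A" for c y w
    using that(1)
  proof (induction rule: derivation_graph.induct)
    case zero
    then show ?case
      using derivation_graph.zero c by (simp add: closed g_zero)
  next
    case (lin q w k)
    note q = lin G_closed[OF lin(1)]
    have "c \<otimes>\<^bsub>B\<^esub> (q \<otimes>\<^bsub>B\<^esub> b \<oplus>\<^bsub>B\<^esub> k) = (c \<otimes>\<^bsub>B\<^esub> q) \<otimes>\<^bsub>B\<^esub> b \<oplus>\<^bsub>B\<^esub> c \<otimes>\<^bsub>B\<^esub> k"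
      using q c by (simp add: closed B.r_distr B.m_assoc)
    moreover have "g c \<otimes>\<^bsub>T\<^esub> (g b \<otimes>\<^bsub>T\<^esub> w \<oplus>\<^bsub>T\<^esub> g q \<otimes>\<^bsub>T\<^esub> t \<oplus>\<^bsub>T\<^esub> \<delta> k) \<oplus>\<^bsub>T\<^esub> g (q \<otimes>\<^bsub>B\<^esub> b \<oplus>\<^bsub>B\<^esub> k) \<otimes>\<^bsub>T\<^esub> \<delta> c =
        g b \<otimes>\<^bsub>T\<^esub> (g c \<otimes>\<^bsub>T\<^esub> w \<oplus>\<^bsub>T\<^esub> g q \<otimes>\<^bsub>T\<^esub> \<delta> c) \<oplus>\<^bsub>T\<^esub> g (c \<otimes>\<^bsub>B\<^esub> q) \<otimes>\<^bsub>T\<^esub> t \<oplus>\<^bsub>T\<^esub> \<delta> (c \<otimes>\<^bsub>B\<^esub> k)"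
      using q c by (simp add: closed g_add g_mult \<delta>_mult T.l_distr T.r_distr T.a_ac T.m_ac)
    ultimately show ?case
      using derivation_graph.lin[OF lin.IH subringE(6)[OF A c lin(2)]] by simp
  qed
  have G_mult: "?G (y \<otimes>\<^bsub>B\<^esub> y') (g y \<otimes>\<^bsub>T\<^esub> w' \<oplus>\<^bsub>T\<^esub> g y' \<otimes>\<^bsub>T\<^esub> w)" if "?G y w" and y': "?G y' w'" for y y' w w'
    using that(1)
  proof (induction rule: derivation_graph.induct)
    case zero
    then show ?case
      using derivation_graph.zero G_closed[OF y'] by (simp add: closed g_zero)
  next
    case (lin q w k)
    note q = lin G_closed[OF lin(1)] G_closed[OF y']
    \<comment> \<open>The product splits into a Horner element with constant term 0, where \<delta>
      vanishes, and \<open>k \<otimes> y'\<close>, which \<open>G_smult\<close> covers.\<close>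
    have "(q \<otimes>\<^bsub>B\<^esub> b \<oplus>\<^bsub>B\<^esub> k) \<otimes>\<^bsub>B\<^esub> y' = ((q \<otimes>\<^bsub>B\<^esub> y') \<otimes>\<^bsub>B\<^esub> b \<oplus>\<^bsub>B\<^esub> \<zero>\<^bsub>B\<^esub>) \<oplus>\<^bsub>B\<^esub> k \<otimes>\<^bsub>B\<^esub> y'"
      using q by (simp add: closed B.l_distr B.r_distr B.m_ac)
    moreover have "g (q \<otimes>\<^bsub>B\<^esub> b \<oplus>\<^bsub>B\<^esub> k) \<otimes>\<^bsub>T\<^esub> w' \<oplus>\<^bsub>T\<^esub> g y' \<otimes>\<^bsub>T\<^esub> (g b \<otimes>\<^bsub>T\<^esub> w \<oplus>\<^bsub>T\<^esub> g q \<otimes>\<^bsub>T\<^esub> t \<oplus>\<^bsub>T\<^esub> \<delta> k) =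
        (g b \<otimes>\<^bsub>T\<^esub> (g q \<otimes>\<^bsub>T\<^esub> w' \<oplus>\<^bsub>T\<^esub> g y' \<otimes>\<^bsub>T\<^esub> w) \<oplus>\<^bsub>T\<^esub> g (q \<otimes>\<^bsub>B\<^esub> y') \<otimes>\<^bsub>T\<^esub> t \<oplus>\<^bsub>T\<^esub> \<delta> \<zero>\<^bsub>B\<^esub>) \<oplus>\<^bsub>T\<^esub>
        (g k \<otimes>\<^bsub>T\<^esub> w' \<oplus>\<^bsub>T\<^esub> g y' \<otimes>\<^bsub>T\<^esub> \<delta> k)"
      using q by (simp add: closed g_add g_mult \<delta>_zero T.l_distr T.r_distr T.a_ac T.m_ac)
    ultimately show ?case
      using G_add[OF derivation_graph.lin[OF lin.IH subringE(2)[OF A]] G_smult[OF y' lin(2)]] by simp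
  qed
  have total: "\<exists>w. ?G y w" if "y \<in> ?S" for y
    using that by (induction rule: B.simple_extension.induct) (blast intro: derivation_graph.intros)+
  note decomp = B.transcendental_decomp_unique[OF A b tr]
  \<comment> \<open>Zero arises from both introduction rules, from the second with \<open>q\<close>
    and \<open>k\<close> zero; this overlap is settled before \<open>unique\<close>, which compares
    rules.\<close>
  have zero_unique: "w = \<zero>\<^bsub>T\<^esub>" if "?G y w" "y = \<zero>\<^bsub>B\<^esub>" for y w
    using that
  proof (induction rule: derivation_graph.induct)
    case (lin q w k)
    then have eq: "q \<otimes>\<^bsub>B\<^esub> b \<oplus>\<^bsub>B\<^esub> k = \<zero>\<^bsub>B\<^esub> \<otimes>\<^bsub>B\<^esub> b \<oplus>\<^bsub>B\<^esub> \<zero>\<^bsub>B\<^esub>"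
      using b by simp
    have "q = \<zero>\<^bsub>B\<^esub>" "k = \<zero>\<^bsub>B\<^esub>"
      using decomp[OF conjunct1[OF G_closed[OF lin(1)]] S(2) lin(2) subringE(2)[OF A] eq] .
    then show ?case
      using lin.IH by (simp add: closed g_zero \<delta>_zero)
  qed simp
  have unique: "w = w'" if "?G y w" "?G y w'" for y w w'
    using that
  proof (induction arbitrary: w' rule: derivation_graph.induct)
    case zero
    then show ?case using zero_unique by simp
  next
    case (lin q w k)
    have "?G (q \<otimes>\<^bsub>B\<^esub> b \<oplus>\<^bsub>B\<^esub> k) w'" by fact
    then show ?case
    proof cases
      case zero
      show ?thesis
        using zero_unique[OF derivation_graph.lin[OF lin(1,2)] zero(1)] zero(2) by simp
    next
      case (lin q' v k')
      have "q = q'" "k = k'"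
        using decomp[OF conjunct1[OF G_closed[OF \<open>?G q w\<close>]] conjunct1[OF G_closed[OF lin(3)]]
            \<open>k \<in> A\<close> lin(4,1)] .
      then show ?thesis using lin lin.IH by simp
    qed
  qed
  define e where "e y = (THE w. ?G y w)" for y
  have e_eq: "e y = w" if "?G y w" for y w
    unfolding e_def using that unique by blast
  have e: "?G y (e y)" if "y \<in> ?S" for y
    using total[OF that] e_eq by auto
  \<comment> \<open>A constant \<open>a\<close> has Horner form with head 0, so only the term
    \<open>\<delta> a\<close> survives.\<close>
  have G_const: "?G a (\<delta> a)" if "a \<in> A" for a
    using derivation_graph.lin[OF derivation_graph.zero that, of B b T g \<delta> t] that
    by (simp add: closed g_zero)
  have "derivation (B\<lparr>carrier := ?S\<rparr>) (scalars_along g T) e"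
    by (rule derivation_alongI) (auto simp: G_closed[OF e] intro!: e_eq G_add G_mult e)
  moreover have "e a = \<delta> a" if "a \<in> A" for a
    by (rule e_eq[OF G_const[OF that]])
  \<comment> \<open>Here \<open>b\<close> is read as head 1 and constant 0; \<delta> vanishes at
    both, which leaves \<open>g 1\<close> times \<open>t\<close>.\<close>
  moreover have "e b = t"
    using e_eq[OF derivation_graph.lin[OF G_const[OF subringE(3)[OF A]] subringE(2)[OF A]]]
    by (simp add: closed g_one \<delta>_one \<delta>_zero)
  ultimately show ?thesis by blast
qed

section \<open>The extension theorem\<close>

text \<open>Horner form in the right factor peels off one factor 1 \<otimes> b at a time, and the
  remaining constants from \<open>A\<close> move to the left factor. This provides
  \<open>gen\<close> for \<open>biderivation_extension\<close>.\<close>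

lemma tensor_simple_extension_generated:
  assumes R: "algebra K R" and "cring B" and A: "subring A B" and b: "b \<in> carrier B"
    and K: "carrier K = A"
    and Ab: "Ab = scalars_along (\<lambda>a. a) (B\<lparr>carrier := ring.simple_extension B A b\<rparr>)"
    and alg: "algebra K Ab"
  shows "carrier (tensor K R Ab) = generate_ring (tensor K R Ab)
    (insert (pure_tensor K R Ab \<one>\<^bsub>R\<^esub> b) ((\<lambda>r. pure_tensor K R Ab r \<one>\<^bsub>B\<^esub>) ` carrier R))"
    (is "_ = generate_ring _ ?G")
proof
  interpret B: cring B by fact
  interpret RC: cring R by (rule algebra.axioms(2)[OF R])
  interpret R: algebra K R by fact
  interpret P: cring "tensor K R Ab" by (rule tensor_cring[OF R alg])
  note S = subringE[OF B.simple_extension_subring[OF A b]]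
  have AbS: "carrier Ab = B.simple_extension A b" and Ab1: "\<one>\<^bsub>Ab\<^esub> = \<one>\<^bsub>B\<^esub>"
    by (simp_all add: Ab)
  have bS: "b \<in> carrier Ab"
    using B.simple_extension_mem[OF A b] AbS by simp
  have AS: "a \<in> carrier Ab" if "a \<in> A" for a
    using B.simple_extension_incl[OF subringE(1)[OF A] b] that AbS by blast
  have one: "\<one>\<^bsub>B\<^esub> \<in> carrier Ab"
    using S(3) AbS by simp
  have G: "?G \<subseteq> carrier (tensor K R Ab)"
    using pure_tensor_closed[OF R alg] bS one by auto
  note gen = subringE[OF P.generate_ring_is_subring[OF G]]
  show "generate_ring (tensor K R Ab) ?G \<subseteq> carrier (tensor K R Ab)"
    by (rule gen(1))
  have \<iota>: "pure_tensor K R Ab r \<one>\<^bsub>B\<^esub> \<in> generate_ring (tensor K R Ab) ?G" if "r \<in> carrier R" for r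
    using that by (intro generate_ring.incl) blast
  \<comment> \<open>Balancing turns r \<otimes> a into (a r) \<otimes> 1, which is one of the
    generators.\<close>
  have const: "pure_tensor K R Ab r a \<in> generate_ring (tensor K R Ab) ?G" if "r \<in> carrier R" "a \<in> A" for r a
  proof -
    have "a \<odot>\<^bsub>Ab\<^esub> \<one>\<^bsub>B\<^esub> = a"
      using subsetD[OF subringE(1)[OF A] that(2)] by (simp add: Ab)
    then have "pure_tensor K R Ab r a = pure_tensor K R Ab (a \<odot>\<^bsub>R\<^esub> r) \<one>\<^bsub>B\<^esub>"
      using pure_tensor_balance[OF R alg _ that(1) one, of a] that(2) K by simp
    then show ?thesis
      using \<iota> that K by simp
  qed
  have pure: "pure_tensor K R Ab r y \<in> generate_ring (tensor K R Ab) ?G"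
    if y: "y \<in> B.simple_extension A b" and r: "r \<in> carrier R" for r y
    using y
  proof (induction rule: B.simple_extension.induct)
    case zero
    show ?case by (rule const[OF r subringE(2)[OF A]])
  next
    case (lin q k)
    have qb: "q \<otimes>\<^bsub>B\<^esub> b \<in> carrier Ab"
      using S(6)[OF lin(1)] bS by (simp add: AbS)
    have "pure_tensor K R Ab r (q \<otimes>\<^bsub>B\<^esub> b \<oplus>\<^bsub>B\<^esub> k) =
        pure_tensor K R Ab r (q \<otimes>\<^bsub>B\<^esub> b) \<oplus>\<^bsub>tensor K R Ab\<^esub> pure_tensor K R Ab r k"
      using pure_tensor_add_right[OF R alg r qb AS[OF lin(2)]] by (simp add: Ab)
    also have "pure_tensor K R Ab r (q \<otimes>\<^bsub>B\<^esub> b) =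
        pure_tensor K R Ab r q \<otimes>\<^bsub>tensor K R Ab\<^esub> pure_tensor K R Ab \<one>\<^bsub>R\<^esub> b"
      using pure_tensor_mult[OF R alg r RC.one_closed _ bS, of q] lin(1) r by (simp add: Ab)
    finally show ?case
      using gen(7)[OF gen(6)[OF lin.IH generate_ring.incl] const[OF r lin(2)]] by simp
  qed
  show "carrier (tensor K R Ab) \<subseteq> generate_ring (tensor K R Ab) ?G"
  proof
    fix U assume "U \<in> carrier (tensor K R Ab)"
    with R alg show "U \<in> generate_ring (tensor K R Ab) ?G"
    proof (induction U rule: tensor_induct)
      case (pure r y)
      then show ?case
        using \<open>\<And>y r. y \<in> B.simple_extension A b \<Longrightarrow> r \<in> carrier R \<Longrightarrow>
          pure_tensor K R Ab r y \<in> generate_ring (tensor K R Ab) ?G\<close> by (simp add: AbS)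
    next
      case (diff U V)
      then show ?case by (simp add: P.minus_eq gen)
    qed
  qed
qed

theorem theorem2p13:
  fixes B :: "('a, 'n) ring_scheme" and A :: "'a set" and b :: 'a
    and K :: "('a, 'n) ring_scheme" and R :: "('a, 'r, 'p) module_scheme"
    and Ab BA :: "('a, 'a) module"
    and P T :: "('r \<times> 'a \<Rightarrow>\<^sub>0 int) set ring"
    and T\<^sub>R :: "('r, ('r \<times> 'a \<Rightarrow>\<^sub>0 int) set) module"
    and T\<^sub>P :: "(('r \<times> 'a \<Rightarrow>\<^sub>0 int) set, ('r \<times> 'a \<Rightarrow>\<^sub>0 int) set) module"
    and \<iota> :: "'r \<Rightarrow> ('r \<times> 'a \<Rightarrow>\<^sub>0 int) set" and b\<^sub>P :: "('r \<times> 'a \<Rightarrow>\<^sub>0 int) set"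
    and D :: "'r \<Rightarrow> ('r \<times> 'a \<Rightarrow>\<^sub>0 int) set"
    and E :: "('r \<times> 'a \<Rightarrow>\<^sub>0 int) set \<Rightarrow> ('r \<times> 'a \<Rightarrow>\<^sub>0 int) set"
    and \<beta> :: "'r \<Rightarrow> 'r \<Rightarrow> ('r \<times> 'a \<Rightarrow>\<^sub>0 int) set"
  assumes B: "cring B" and A: "subring A B"
    and b: "b \<in> carrier B" and transcendental: "ring.transcendental B A b"
    and K: "K = B\<lparr>carrier := A\<rparr>" and R: "algebra K R"
    and Ab: "Ab = scalars_along (\<lambda>a. a) (B\<lparr>carrier := ring.simple_extension B A b\<rparr>)"
    and BA: "BA = scalars_along (\<lambda>a. a) B"
    and P: "P = tensor K R Ab" and T: "T = tensor K R BA"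
    and \<iota>: "\<iota> = (\<lambda>r. pure_tensor K R Ab r \<one>\<^bsub>B\<^esub>)"
    and bP: "b\<^sub>P = pure_tensor K R Ab \<one>\<^bsub>R\<^esub> b"
    and TR: "T\<^sub>R = scalars_along (\<lambda>r. pure_tensor K R BA r \<one>\<^bsub>B\<^esub>) T"
    and TP: "T\<^sub>P = scalars_along (tensor_map K R BA (\<lambda>r. r) (\<lambda>c. c)) T"
    and D: "derivation R T\<^sub>R D" and E: "derivation P T\<^sub>P E"
    and \<beta>: "biderivation R T\<^sub>R \<beta>"
  shows "\<exists>\<gamma>.
    (biderivation P T\<^sub>P \<gamma> \<and> extends_along R \<iota> \<gamma> \<beta> \<and>
      (\<forall>r\<in>carrier R. \<gamma> (\<iota> r) b\<^sub>P = D r) \<and> (\<forall>x\<in>carrier P. \<gamma> b\<^sub>P x = E x)) \<and>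
    (\<forall>\<gamma>'.
      biderivation P T\<^sub>P \<gamma>' \<and> extends_along R \<iota> \<gamma>' \<beta> \<and>
      (\<forall>r\<in>carrier R. \<gamma>' (\<iota> r) b\<^sub>P = D r) \<and> (\<forall>x\<in>carrier P. \<gamma>' b\<^sub>P x = E x) \<longrightarrow>
      (\<forall>x\<in>carrier P. \<forall>y\<in>carrier P. \<gamma>' x y = \<gamma> x y))"
proof -
  interpret B: cring B by fact
  interpret K: cring K by (rule algebra.R_cring[OF R])
  interpret RC: cring R by (rule algebra.axioms(2)[OF R])
  interpret R: algebra K R by fact
  let ?S = "B.simple_extension A b"
  note S = subringE[OF B.simple_extension_subring[OF A b]]
  have S_cring: "cring (B\<lparr>carrier := ?S\<rparr>)"
    using B.subcring_iff[OF S(1)] B.subcringI'[OF B.simple_extension_subring[OF A b]] by simp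
  have KA: "carrier K = A"
    by (simp add: K)
  have AS: "a \<in> ?S" if "a \<in> A" for a
    using B.simple_extension_incl[OF subringE(1)[OF A] b] that by blast
  have AbS: "carrier Ab = ?S" and Ab1: "\<one>\<^bsub>Ab\<^esub> = \<one>\<^bsub>B\<^esub>"
    by (simp_all add: Ab)
  have bS: "b \<in> carrier Ab"
    using B.simple_extension_mem[OF A b] AbS by simp
  have Ab_alg: "algebra K Ab"
    unfolding Ab by (rule scalars_along_algebra[OF K.cring_axioms S_cring])
      (rule ring_hom_memI, simp_all add: K AS)
  have BA_alg: "algebra K BA"
    unfolding BA by (rule scalars_along_algebra[OF K.cring_axioms B.cring_axioms])
      (rule ring_hom_memI, simp_all add: K subsetD[OF subringE(1)[OF A]])
  interpret P: cring P unfolding P by (rule tensor_cring[OF R Ab_alg])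
  interpret T: cring T unfolding T by (rule tensor_cring[OF R BA_alg])
  \<comment> \<open>The map from R \<otimes> A[b] to R \<otimes> B induced by the inclusion; it
    gives the action in \<open>T\<^sub>P\<close>.\<close>
  define \<phi> :: "('r \<times> 'a \<Rightarrow>\<^sub>0 int) set \<Rightarrow> ('r \<times> 'a \<Rightarrow>\<^sub>0 int) set"
    where "\<phi> = tensor_map K R BA (\<lambda>r. r) (\<lambda>c. c)"
  have id_R: "(\<lambda>r. r) \<in> ring_hom R R"
    by (rule ring_hom_memI) simp_all
  have id_Ab: "(\<lambda>c. c) \<in> ring_hom Ab BA"
    by (rule ring_hom_memI) (simp_all add: Ab BA subsetD[OF S(1)])
  have \<phi>: "\<phi> \<in> ring_hom P T"
    unfolding \<phi>_def P T
    by (rule tensor_map_hom[OF R Ab_alg R BA_alg id_R id_Ab]) (simp_all add: Ab BA)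
  have \<phi>_pure: "\<phi> (pure_tensor K R Ab x y) = pure_tensor K R BA x y" if "x \<in> carrier R" "y \<in> ?S" for x y
    unfolding \<phi>_def
    by (rule tensor_map_pure_tensor[OF R Ab_alg R BA_alg id_R id_Ab]) (use that in \<open>simp_all add: Ab BA\<close>)
  have \<iota>_hom: "\<iota> \<in> ring_hom R P"
    using pure_tensor_left_hom[OF R Ab_alg] by (simp add: \<iota> P Ab1)
  have gen: "carrier P = generate_ring P (insert b\<^sub>P (\<iota> ` carrier R))"
    unfolding P bP \<iota> by (rule tensor_simple_extension_generated[OF R B A b KA Ab Ab_alg])
  \<comment> \<open>\<open>T\<^sub>R\<close> acts through pure tensors of \<open>T\<close>, while
    the extension lemma acts along \<phi> after \<iota>; on the carrier of \<open>R\<close> these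
    coincide.\<close>
  have TR': "derivation R T\<^sub>R d \<longleftrightarrow> derivation R (scalars_along (\<lambda>r. \<phi> (\<iota> r)) T) d" for d
    unfolding TR by (rule derivation_along_cong[OF RC.ring_axioms]) (simp_all add: \<iota> \<phi>_pure S(3))
  \<comment> \<open>The extension property: \<delta> is pulled back to \<open>A\<close>, extended
    over A[b] with value \<open>t\<close> at \<open>b\<close>, and the result is glued with \<delta>
    on the tensor product.\<close>
  have ext: "\<exists>d. derivation P (scalars_along \<phi> T) d \<and> (\<forall>r\<in>carrier R. d (\<iota> r) = \<delta> r) \<and> d b\<^sub>P = t"
    if \<delta>: "derivation R (scalars_along (\<lambda>r. \<phi> (\<iota> r)) T) \<delta>" and t: "t \<in> carrier T" for \<delta> t
  proof -
    let ?g = "\<lambda>y. \<phi> (pure_tensor K R Ab \<one>\<^bsub>R\<^esub> y)"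
    have g: "?g \<in> ring_hom Ab T"
      using ring_hom_trans[OF pure_tensor_right_hom[OF R Ab_alg] \<phi>[unfolded P]] by (simp add: comp_def)
    have g': "?g \<in> ring_hom (B\<lparr>carrier := ?S\<rparr>) T"
      using g by (simp add: ring_hom_def Ab)
    have smult_hom: "(\<lambda>a. a \<odot>\<^bsub>R\<^esub> \<one>\<^bsub>R\<^esub>) \<in> ring_hom K R"
      by (rule ring_hom_memI)
        (simp_all add: R.smult_l_distr R.smult_assoc1 R.smult_assoc2)
    have balance: "pure_tensor K R Ab (a \<odot>\<^bsub>R\<^esub> \<one>\<^bsub>R\<^esub>) \<one>\<^bsub>B\<^esub> = pure_tensor K R Ab \<one>\<^bsub>R\<^esub> a" if "a \<in> A" for a
      using pure_tensor_balance[OF R Ab_alg, of a "\<one>\<^bsub>R\<^esub>" "\<one>\<^bsub>B\<^esub>"] that S(3) subsetD[OF subringE(1)[OF A] that]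
      by (simp add: KA AbS) (simp add: Ab)
    \<comment> \<open>Pulled back along the structure map of \<open>R\<close>, \<delta> is a
      derivation for the action through \<open>R\<close>; \<open>balance\<close> converts this to
      the action through 1 \<otimes> a.\<close>
    have "derivation K (scalars_along ?g T) (\<lambda>a. \<delta> (a \<odot>\<^bsub>R\<^esub> \<one>\<^bsub>R\<^esub>))"
      using derivation_along_comp[OF smult_hom \<delta>]
      by (subst derivation_along_cong[OF K.ring_axioms, where f' = "\<lambda>a. \<phi> (\<iota> (a \<odot>\<^bsub>R\<^esub> \<one>\<^bsub>R\<^esub>))"])
        (simp_all add: \<iota> balance KA)
    then obtain e where e: "derivation (B\<lparr>carrier := ?S\<rparr>) (scalars_along ?g T) e"
        "\<forall>a\<in>A. e a = \<delta> (a \<odot>\<^bsub>R\<^esub> \<one>\<^bsub>R\<^esub>)" "e b = t"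
      using transcendental_derivation[OF B A b transcendental T.cring_axioms g' _ t] unfolding K by blast
    have "derivation Ab (scalars_along ?g T) e"
      using e(1) by (simp add: derivation_def Ab)
    \<comment> \<open>This agreement on the images of \<open>K\<close> is what lets
      \<open>tensor_derivation\<close> glue \<delta> and \<open>e\<close>.\<close>
    moreover have "\<delta> (a \<odot>\<^bsub>R\<^esub> \<one>\<^bsub>R\<^esub>) = e (a \<odot>\<^bsub>Ab\<^esub> \<one>\<^bsub>Ab\<^esub>)" if "a \<in> carrier K" for a
      using e(2) that subsetD[OF subringE(1)[OF A], of a] by (simp add: KA Ab)
    ultimately obtain d where "derivation P (scalars_along \<phi> T) d"
      "\<forall>r\<in>carrier R. d (\<iota> r) = \<delta> r" "\<forall>y\<in>carrier Ab. d (pure_tensor K R Ab \<one>\<^bsub>R\<^esub> y) = e y"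
      using tensor_derivation[OF R Ab_alg T.cring_axioms \<phi>[unfolded P], of \<delta> e] \<delta>
      unfolding P \<iota> Ab1 by blast
    then show ?thesis
      using e(3) bS bP by blast
  qed
  have bP_closed: "b\<^sub>P \<in> carrier P"
    unfolding bP P by (rule pure_tensor_closed[OF R Ab_alg RC.one_closed bS])
  have "biderivation R (scalars_along (\<lambda>r. \<phi> (\<iota> r)) T) \<beta>"
    using \<beta> unfolding biderivation_def TR' .
  moreover have TP': "T\<^sub>P = scalars_along \<phi> T"
    by (simp add: TP \<phi>_def)
  ultimately show ?thesis
    using biderivation_extension[OF RC.ring_axioms P.ring_axioms T.cring_axioms \<phi> \<iota>_hom bP_closed gen ext
      D[unfolded TR'] E[unfolded TP']] unfolding TP' by blast
qed

end
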